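(* Let $N\ge 2$ and let $\rho$ be a density operator on a finite-dimensional Hilbert space $H_1\otimes H_2\otimes\cdots\otimes H_N$. For a nonempty proper subset $\gamma\subset\{1,\dots,N\}$ with complement $\gamma'$, define the $\gamma$-discord $$\mathcal{D}_\gamma(\rho)=\min\Big[S\big(\rho\,\|\,\Phi^{\gamma}(\rho)\big)-S\big(\rho_\gamma\,\|\,\Phi_\gamma(\rho_\gamma)\big)-S\big(\rho_{\gamma'}\,\|\,\Phi_{\gamma'}(\rho_{\gamma'})\big)\Big],$$ where the minimum is over all complete sets $\{\Pi_\gamma^k\}_k$ of rank-one orthogonal projectors on $H_\gamma=\bigotimes_{i\in\gamma}H_i$ and $\{\Pi_{\gamma'}^{k'}\}_{k'}$ on $H_{\gamma'}=\bigotimes_{i\in\gamma'}H_i$, and $\Phi^{\gamma}(\rho)=\sum_{k,k'}(\Pi_{\gamma}^{k}\otimes\Pi_{\gamma'}^{k'})\rho(\Pi_{\gamma}^{k}\otimes\Pi_{\gamma'}^{k'})$, $\Phi_\gamma(\rho_\gamma)=\sum_k\Pi_\gamma^k\rho_\gamma\Pi_\gamma^k$, $\Phi_{\gamma'}(\rho_{\gamma'})=\sum_{k'}\Pi_{\gamma'}^{k'}\rho_{\gamma'}\Pi_{\gamma'}^{k'}$. Define the genuine multipartite quantum discord $\mathcal{D}(\rho)=\min_\gamma \mathcal{D}_\gamma(\rho)$, the minimum over all nonempty proper subsets $\gamma$. Then $\mathcal{D}(\rho)\ge 0$.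
   Context: $S(\rho\|\sigma)=\mathrm{Tr}(\rho\log_2\rho-\rho\log_2\sigma)$ is the quantum relative entropy. $\rho_\gamma$ and $\rho_{\gamma'}$ denote the reduced density operators of $\rho$ on the subsystems indexed by $\gamma$ and $\gamma'$ (partial traces over the complementary factors). *)

theory Defs
  imports "HOL-Analysis.Analysis" "Jordan_Normal_Form.DL_Rank"
begin

definition adj :: "complex mat \<Rightarrow> complex mat" where
  "adj A = mat (dim_col A) (dim_row A) (\<lambda>(i,j). cnj (A $$ (j,i)))"

definition tr :: "complex mat \<Rightarrow> complex" where
  "tr A = (\<Sum>i<dim_row A. A $$ (i,i))"

definition unitary_mat :: "nat \<Rightarrow> complex mat \<Rightarrow> bool" where
  "unitary_mat n U \<longleftrightarrow> U \<in> carrier_mat n n \<and> adj U * U = 1\<^sub>m n \<and> U * adj U = 1\<^sub>m n"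

definition density_op :: "nat \<Rightarrow> complex mat \<Rightarrow> bool" where
  "density_op n \<rho> \<longleftrightarrow> \<rho> \<in> carrier_mat n n \<and> adj \<rho> = \<rho>
     \<and> (\<forall>v \<in> carrier_vec n. 0 \<le> (\<Sum>i<n. cnj (v $ i) * (\<rho> *\<^sub>v v) $ i))
     \<and> tr \<rho> = 1"

text \<open>Binary logarithm with the convention log 0 = 0 (i.e. 0 log 0 = 0).\<close>
definition log2' :: "real \<Rightarrow> real" where
  "log2' x = (if x > 0 then log 2 x else 0)"

definition mat_log2 :: "complex mat \<Rightarrow> complex mat" where
  "mat_log2 A = (SOME L. \<exists>U d. unitary_mat (dim_row A) U
      \<and> A = U * mat_diag (dim_row A) (\<lambda>i. complex_of_real (d i)) * adj U
      \<and> L = U * mat_diag (dim_row A) (\<lambda>i. complex_of_real (log2' (d i))) * adj U)"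

definition rel_entropy :: "complex mat \<Rightarrow> complex mat \<Rightarrow> real" where
  "rel_entropy \<rho> \<sigma> = Re (tr (\<rho> * mat_log2 \<rho> - \<rho> * mat_log2 \<sigma>))"

text \<open>Subsystems are indexed by 0..<N; subsystem i has dimension d i.
  The space H_S for S a set of subsystems has the mixed-radix product basis.\<close>

definition sdim :: "(nat \<Rightarrow> nat) \<Rightarrow> nat set \<Rightarrow> nat" where
  "sdim d S = (\<Prod>i\<in>S. d i)"

definition place :: "(nat \<Rightarrow> nat) \<Rightarrow> nat set \<Rightarrow> nat \<Rightarrow> nat" where
  "place d S i = (\<Prod>j\<in>{j\<in>S. j < i}. d j)"

definition digit :: "(nat \<Rightarrow> nat) \<Rightarrow> nat set \<Rightarrow> nat \<Rightarrow> nat \<Rightarrow> nat" where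
  "digit d S m i = m div place d S i mod d i"

definition encode :: "(nat \<Rightarrow> nat) \<Rightarrow> nat set \<Rightarrow> (nat \<Rightarrow> nat) \<Rightarrow> nat" where
  "encode d S x = (\<Sum>i\<in>S. x i * place d S i)"

text \<open>basis index of H_T obtained by restricting basis index m of H_S (T \<subseteq> S)\<close>
definition sub_idx :: "(nat \<Rightarrow> nat) \<Rightarrow> nat set \<Rightarrow> nat set \<Rightarrow> nat \<Rightarrow> nat" where
  "sub_idx d S T m = encode d T (digit d S m)"

definition join_idx :: "(nat \<Rightarrow> nat) \<Rightarrow> nat \<Rightarrow> nat set \<Rightarrow> nat \<Rightarrow> nat \<Rightarrow> nat" where
  "join_idx d N \<gamma> a c = encode d {..<N}
     (\<lambda>i. if i \<in> \<gamma> then digit d \<gamma> a i else digit d ({..<N} - \<gamma>) c i)"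

definition ptrace :: "(nat \<Rightarrow> nat) \<Rightarrow> nat \<Rightarrow> nat set \<Rightarrow> complex mat \<Rightarrow> complex mat" where
  "ptrace d N \<gamma> \<rho> = mat (sdim d \<gamma>) (sdim d \<gamma>)
     (\<lambda>(a,b). \<Sum>c<sdim d ({..<N} - \<gamma>). \<rho> $$ (join_idx d N \<gamma> a c, join_idx d N \<gamma> b c))"

definition tensor_op :: "(nat \<Rightarrow> nat) \<Rightarrow> nat \<Rightarrow> nat set \<Rightarrow> complex mat \<Rightarrow> complex mat \<Rightarrow> complex mat" where
  "tensor_op d N \<gamma> A B = mat (sdim d {..<N}) (sdim d {..<N})
     (\<lambda>(m,n). A $$ (sub_idx d {..<N} \<gamma> m, sub_idx d {..<N} \<gamma> n)
            * B $$ (sub_idx d {..<N} ({..<N} - \<gamma>) m, sub_idx d {..<N} ({..<N} - \<gamma>) n))"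

definition rank_one_pvm :: "nat \<Rightarrow> nat \<Rightarrow> (nat \<Rightarrow> complex mat) \<Rightarrow> bool" where
  "rank_one_pvm n m P \<longleftrightarrow>
     (\<forall>k<m. P k \<in> carrier_mat n n \<and> P k * P k = P k \<and> adj (P k) = P k
            \<and> vec_space.rank n (P k) = 1)
     \<and> (\<forall>k<m. \<forall>l<m. k \<noteq> l \<longrightarrow> P k * P l = 0\<^sub>m n n)
     \<and> mat n n (\<lambda>(i,j). \<Sum>k<m. P k $$ (i,j)) = 1\<^sub>m n"

definition dephase :: "nat \<Rightarrow> nat \<Rightarrow> (nat \<Rightarrow> complex mat) \<Rightarrow> complex mat \<Rightarrow> complex mat" where
  "dephase n m P A = mat n n (\<lambda>(i,j). \<Sum>k<m. (P k * A * P k) $$ (i,j))"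

definition dephase2 :: "(nat \<Rightarrow> nat) \<Rightarrow> nat \<Rightarrow> nat set \<Rightarrow> nat \<Rightarrow> (nat \<Rightarrow> complex mat)
    \<Rightarrow> nat \<Rightarrow> (nat \<Rightarrow> complex mat) \<Rightarrow> complex mat \<Rightarrow> complex mat" where
  "dephase2 d N \<gamma> m P m' Q \<rho> = mat (sdim d {..<N}) (sdim d {..<N})
     (\<lambda>(i,j). \<Sum>k<m. \<Sum>k'<m'.
        (tensor_op d N \<gamma> (P k) (Q k') * \<rho> * tensor_op d N \<gamma> (P k) (Q k')) $$ (i,j))"

definition gamma_discord :: "(nat \<Rightarrow> nat) \<Rightarrow> nat \<Rightarrow> nat set \<Rightarrow> complex mat \<Rightarrow> real" where
  "gamma_discord d N \<gamma> \<rho> = Inf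
     {rel_entropy \<rho> (dephase2 d N \<gamma> m P m' Q \<rho>)
      - rel_entropy (ptrace d N \<gamma> \<rho>) (dephase (sdim d \<gamma>) m P (ptrace d N \<gamma> \<rho>))
      - rel_entropy (ptrace d N ({..<N} - \<gamma>) \<rho>)
          (dephase (sdim d ({..<N} - \<gamma>)) m' Q (ptrace d N ({..<N} - \<gamma>) \<rho>))
      | m P m' Q. rank_one_pvm (sdim d \<gamma>) m P \<and> rank_one_pvm (sdim d ({..<N} - \<gamma>)) m' Q}"

definition gm_discord :: "(nat \<Rightarrow> nat) \<Rightarrow> nat \<Rightarrow> complex mat \<Rightarrow> real" where
  "gm_discord d N \<rho> = Min ((\<lambda>\<gamma>. gamma_discord d N \<gamma> \<rho>)
      ` {\<gamma>. \<gamma> \<subseteq> {..<N} \<and> \<gamma> \<noteq> {} \<and> \<gamma> \<noteq> {..<N}})"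

end

theory Submission
  imports Defs "HOL-Real_Asymp.Real_Asymp" "Jordan_Normal_Form.Spectral_Radius"
begin

text \<open>
  Since \<open>\<Phi>\<close> dephases in an orthonormal basis, \<open>S(\<rho>\<parallel>\<Phi>(\<rho>)) = S(\<Phi>(\<rho>)) - S(\<rho>)\<close>, so the quantity to be
  minimised is the loss of mutual information under a product measurement. Its nonnegativity is the
  inequality \<open>D(p\<parallel>q) \<le> S(\<rho>\<parallel>\<sigma>)\<close> for \<open>\<sigma> = \<rho>\<^sub>\<gamma> \<otimes> \<rho>\<^sub>\<gamma>\<^sub>'\<close>, where \<open>p\<close> and \<open>q\<close> are the outcome
  distributions of the measurement in the states \<open>\<rho>\<close> and \<open>\<sigma>\<close>.

  Let \<open>\<rho>\<close> have eigenpairs \<open>(r\<^sub>i, e\<^sub>i)\<close>, \<open>\<sigma>\<close> eigenpairs \<open>(s\<^sub>j, f\<^sub>j)\<close>, let \<open>c\<^sub>i\<^sub>j = \<langle>e\<^sub>i, f\<^sub>j\<rangle>\<close> and let \<open>(g\<^sub>k)\<close> be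
  the measured basis. The function
  \<open>G(t) = (\<Sum>i j. r\<^sub>i |c\<^sub>i\<^sub>j|\<^sup>2 ln (s\<^sub>j + t r\<^sub>i)) - (\<Sum>k. p\<^sub>k ln (q\<^sub>k + t p\<^sub>k))\<close> is nondecreasing on
  \<open>[0,\<infinity>)\<close>, and comparing \<open>G(0)\<close> with the limit of \<open>G\<close> at infinity gives the inequality. For the
  monotonicity, \<open>\<Sum>i j. r\<^sub>i\<^sup>2 |c\<^sub>i\<^sub>j|\<^sup>2 / (s\<^sub>j + t r\<^sub>i)\<close> is the supremum over operators \<open>X\<close> of
  \<open>2 Re Tr(\<rho> X) - Tr(\<sigma> X X\<^sup>*) - t Tr(\<rho> X\<^sup>* X)\<close>, and the operator \<open>X\<close> that is diagonal in the measured
  basis with entries \<open>p\<^sub>k / (q\<^sub>k + t p\<^sub>k)\<close> attains \<open>\<Sum>k. p\<^sub>k\<^sup>2 / (q\<^sub>k + t p\<^sub>k)\<close>.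
\<close>

subsection \<open>Measured relative entropy\<close>

lemma cmod_square_of_real: "(complex_of_real (cmod z))\<^sup>2 = z * cnj z"
  using complex_norm_square[of z] by simp

text \<open>Expanding the square leaves the Gram matrix of the vectors \<open>f _ k\<close>, which
  is the identity, so only the terms with \<open>k = k'\<close> survive.\<close>

lemma parseval_orthonormal:
  fixes f :: "'a \<Rightarrow> 'k \<Rightarrow> complex" and z :: "'k \<Rightarrow> complex"
  assumes "finite K"
    and orth: "\<And>k k'. k \<in> K \<Longrightarrow> k' \<in> K \<Longrightarrow> (\<Sum>a\<in>A. f a k * cnj (f a k')) = (if k = k' then 1 else 0)"
  shows "(\<Sum>a\<in>A. (cmod (\<Sum>k\<in>K. f a k * z k))\<^sup>2) = (\<Sum>k\<in>K. (cmod (z k))\<^sup>2)"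
proof -
  have "complex_of_real (\<Sum>a\<in>A. (cmod (\<Sum>k\<in>K. f a k * z k))\<^sup>2)
      = (\<Sum>a\<in>A. \<Sum>k\<in>K. \<Sum>k'\<in>K. (z k * cnj (z k')) * (f a k * cnj (f a k')))"
    unfolding of_real_sum complex_norm_square cnj_sum sum_product
    by (intro sum.cong refl) (simp add: algebra_simps)
  also have "\<dots> = (\<Sum>k\<in>K. \<Sum>k'\<in>K. (z k * cnj (z k')) * (\<Sum>a\<in>A. f a k * cnj (f a k')))"
    unfolding sum_distrib_left
    by (subst sum.swap, intro sum.cong refl, subst sum.swap, rule refl)
  also have "\<dots> = (\<Sum>k\<in>K. \<Sum>k'\<in>K. if k' = k then z k * cnj (z k') else 0)"
    by (intro sum.cong refl) (simp add: orth)
  also have "\<dots> = complex_of_real (\<Sum>k\<in>K. (cmod (z k))\<^sup>2)"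
    using \<open>finite K\<close> by (simp add: cmod_square_of_real)
  finally show ?thesis by (simp only: of_real_eq_iff)
qed

text \<open>For \<open>D > 0\<close> the gap dominates
  \<open>(cmod z - D * cmod X)\<^sup>2 / D\<close>. For \<open>D = 0\<close> both sides vanish, the
  right one because division by zero yields zero.\<close>

lemma complete_square_bound:
  fixes z X :: complex and D :: real
  assumes "D \<ge> 0" and "D = 0 \<Longrightarrow> z = 0"
  shows "2 * Re (z * X) - D * (cmod X)\<^sup>2 \<le> (cmod z)\<^sup>2 / D"
proof (cases "D = 0")
  case False
  then have D: "D > 0" using assms(1) by simp
  have "2 * Re (z * X) \<le> 2 * (cmod z * cmod X)"
    using complex_Re_le_cmod[of "z * X"] by (simp add: norm_mult)
  moreover have "(cmod z)\<^sup>2 / D + D * (cmod X)\<^sup>2 - 2 * (cmod z * cmod X) = (cmod z - D * cmod X)\<^sup>2 / D"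
    using D by (simp add: field_simps power2_eq_square)
  moreover have "(cmod z - D * cmod X)\<^sup>2 / D \<ge> 0" using D by simp
  ultimately show ?thesis by linarith
qed (use assms in simp)

text \<open>Only terms of nonzero weight must avoid the singularity of \<open>ln\<close>; a term of
  weight zero is constant. This admits zero eigenvalues and the endpoint t = 0.\<close>

lemma has_real_derivative_weighted_ln:
  fixes w s r t :: real
  assumes "w \<noteq> 0 \<Longrightarrow> s + t * r > 0"
  shows "((\<lambda>t. w * ln (s + t * r)) has_real_derivative w * r / (s + t * r)) (at t)"
proof (cases "w = 0")
  case False
  then show ?thesis using assms by (auto intro!: derivative_eq_intros simp: field_simps)
qed simp

text \<open>Subtracting \<open>ln t\<close> removes the divergence: for large t the difference of
  logarithms is \<open>ln (r + s / t)\<close>.\<close>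

lemma tendsto_weighted_ln:
  fixes w s r :: real
  assumes "w \<noteq> 0 \<Longrightarrow> r > 0"
  shows "((\<lambda>t. w * (ln (s + t * r) - ln t)) \<longlongrightarrow> w * ln r) at_top"
proof (cases "w = 0")
  case False
  then have "r > 0" using assms by simp
  then have "((\<lambda>t. ln (s + t * r) - ln t) \<longlongrightarrow> ln r) at_top" by real_asymp
  then show ?thesis by (rule tendsto_mult_left)
qed simp

text \<open>The arrays \<open>c\<close>, \<open>h\<close>, \<open>m\<close> hold the overlaps of the
  bases e with f, e with g, and f with g. Assumption \<open>ch\<close> is the resolution of the
  identity in the basis f, and \<open>supp\<close> says that the support of \<rho> lies in that of
  \<sigma>.\<close>

lemma measured_relative_entropy_le:
  fixes c :: "'i \<Rightarrow> 'j \<Rightarrow> complex" and h :: "'i \<Rightarrow> 'k \<Rightarrow> complex" and m :: "'j \<Rightarrow> 'k \<Rightarrow> complex"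
    and r :: "'i \<Rightarrow> real" and s :: "'j \<Rightarrow> real" and p q :: "'k \<Rightarrow> real"
  assumes fin: "finite I" "finite J" "finite K"
    and r: "\<And>i. i \<in> I \<Longrightarrow> r i \<ge> 0" and s: "\<And>j. j \<in> J \<Longrightarrow> s j \<ge> 0"
    and r1: "sum r I = 1"
    and crow: "\<And>i. i \<in> I \<Longrightarrow> (\<Sum>j\<in>J. (cmod (c i j))\<^sup>2) = 1"
    and hrow: "\<And>i. i \<in> I \<Longrightarrow> (\<Sum>k\<in>K. (cmod (h i k))\<^sup>2) = 1"
    and hcol: "\<And>k k'. k \<in> K \<Longrightarrow> k' \<in> K \<Longrightarrow> (\<Sum>i\<in>I. cnj (h i k) * h i k') = (if k = k' then 1 else 0)"
    and mcol: "\<And>k k'. k \<in> K \<Longrightarrow> k' \<in> K \<Longrightarrow> (\<Sum>j\<in>J. m j k * cnj (m j k')) = (if k = k' then 1 else 0)"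
    and ch: "\<And>i k. i \<in> I \<Longrightarrow> k \<in> K \<Longrightarrow> (\<Sum>j\<in>J. c i j * m j k) = h i k"
    and p: "\<And>k. k \<in> K \<Longrightarrow> p k = (\<Sum>i\<in>I. r i * (cmod (h i k))\<^sup>2)"
    and q: "\<And>k. k \<in> K \<Longrightarrow> q k = (\<Sum>j\<in>J. s j * (cmod (m j k))\<^sup>2)"
    and supp: "\<And>i j. i \<in> I \<Longrightarrow> j \<in> J \<Longrightarrow> r i \<noteq> 0 \<Longrightarrow> c i j \<noteq> 0 \<Longrightarrow> s j > 0"
  shows "(\<Sum>k\<in>K. p k * ln (p k)) - (\<Sum>k\<in>K. p k * ln (q k))
     \<le> (\<Sum>i\<in>I. r i * ln (r i)) - (\<Sum>i\<in>I. \<Sum>j\<in>J. r i * (cmod (c i j))\<^sup>2 * ln (s j))"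
proof -
  define w where "w i j = r i * (cmod (c i j))\<^sup>2" for i j
  define G where "G t = (\<Sum>i\<in>I. \<Sum>j\<in>J. w i j * ln (s j + t * r i)) - (\<Sum>k\<in>K. p k * ln (q k + t * p k))" for t
  have p0: "p k \<ge> 0" if "k \<in> K" for k using that r by (simp add: p sum_nonneg)
  have q0: "q k \<ge> 0" if "k \<in> K" for k using that s by (simp add: q sum_nonneg)
  have wpos: "s j > 0" "r i > 0" if "i \<in> I" "j \<in> J" "w i j \<noteq> 0" for i j
    using that r[of i] supp[of i j] by (auto simp: w_def)
  \<comment> \<open>A nonzero \<open>p k\<close> needs some \<open>i\<close> with \<open>r i\<close>
    and \<open>h i k\<close> nonzero. Expanding \<open>h i k\<close> by \<open>ch\<close> yields a
    \<open>j\<close> with \<open>c i j\<close> and \<open>m j k\<close> nonzero, and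
    \<open>supp\<close> makes its term in \<open>q k\<close> positive.\<close>
  have qpos: "q k > 0" if k: "k \<in> K" "p k \<noteq> 0" for k
  proof -
    obtain i where i: "i \<in> I" "r i * (cmod (h i k))\<^sup>2 \<noteq> 0"
      using k(2) unfolding p[OF k(1)] by (meson sum.neutral)
    then have "(\<Sum>j\<in>J. c i j * m j k) \<noteq> 0" using ch k by auto
    then obtain j where j: "j \<in> J" "c i j * m j k \<noteq> 0" by (meson sum.neutral)
    then have "s j * (cmod (m j k))\<^sup>2 > 0" using supp[of i j] i by auto
    then show ?thesis unfolding q[OF k(1)] using j fin s by (intro sum_pos2[where i = j]) auto
  qed
  \<comment> \<open>A nonzero weight forces \<open>s j > 0\<close> or \<open>q k > 0\<close>, so the
    derivative exists on the closed half-line, including t = 0.\<close>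
  have deriv: "(G has_real_derivative (\<Sum>i\<in>I. \<Sum>j\<in>J. w i j * r i / (s j + t * r i))
                 - (\<Sum>k\<in>K. p k * p k / (q k + t * p k))) (at t)" if t: "t \<ge> 0" for t
    unfolding G_def
    by (intro DERIV_diff DERIV_sum has_real_derivative_weighted_ln)
      (use t wpos qpos p0 r in \<open>auto intro!: add_pos_nonneg\<close>)
  have nonneg: "(\<Sum>i\<in>I. \<Sum>j\<in>J. w i j * r i / (s j + t * r i)) - (\<Sum>k\<in>K. p k * p k / (q k + t * p k)) \<ge> 0"
    if t: "t \<ge> 0" for t
  proof -
    \<comment> \<open>\<open>X j i\<close> is the matrix entry, between f and e, of the operator
      with eigenvalue \<open>x k\<close> on the measured vector g. Where the denominator is
      positive, \<open>x k\<close> is the vertex of the parabola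
      \<open>2 * x * p k - x\<^sup>2 * (q k + t * p k)\<close>.\<close>
    define x where "x k = p k / (q k + t * p k)" for k
    define X where "X j i = (\<Sum>k\<in>K. complex_of_real (x k) * (m j k * cnj (h i k)))" for j i
    \<comment> \<open>Parseval over \<open>j\<close>, and below over \<open>i\<close>, gives the
      diagonal entries of \<open>X\<^sup>* X\<close> in the basis e and of
      \<open>X X\<^sup>*\<close> in the basis f.\<close>
    have "(\<Sum>j\<in>J. (cmod (\<Sum>k\<in>K. m j k * (complex_of_real (x k) * cnj (h i k))))\<^sup>2)
        = (\<Sum>k\<in>K. (cmod (complex_of_real (x k) * cnj (h i k)))\<^sup>2)" for i
      using fin mcol by (intro parseval_orthonormal)
    then have Xj: "(\<Sum>j\<in>J. (cmod (X j i))\<^sup>2) = (\<Sum>k\<in>K. (x k)\<^sup>2 * (cmod (h i k))\<^sup>2)" for i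
      by (simp add: X_def mult_ac norm_mult power_mult_distrib)
    have "(\<Sum>i\<in>I. (cmod (\<Sum>k\<in>K. cnj (h i k) * (complex_of_real (x k) * m j k)))\<^sup>2)
        = (\<Sum>k\<in>K. (cmod (complex_of_real (x k) * m j k))\<^sup>2)" for j
      using fin hcol by (intro parseval_orthonormal) auto
    then have Xi: "(\<Sum>i\<in>I. (cmod (X j i))\<^sup>2) = (\<Sum>k\<in>K. (x k)\<^sup>2 * (cmod (m j k))\<^sup>2)" for j
      by (simp add: X_def mult_ac norm_mult power_mult_distrib)
    \<comment> \<open>This is the trace of \<rho> X: contracting \<open>c\<close> with
      \<open>m\<close> by \<open>ch\<close> leaves \<open>h i k * cnj (h i k)\<close>, so only
      outcome probabilities remain.\<close>
    have "(\<Sum>i\<in>I. \<Sum>j\<in>J. r i * c i j * X j i)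
        = (\<Sum>i\<in>I. \<Sum>k\<in>K. complex_of_real (x k) * r i * cnj (h i k) * (\<Sum>j\<in>J. c i j * m j k))"
      unfolding X_def sum_distrib_left
      by (intro sum.cong refl, subst sum.swap, intro sum.cong refl) (simp add: mult_ac)
    also have "\<dots> = (\<Sum>i\<in>I. \<Sum>k\<in>K. complex_of_real (x k * (r i * (cmod (h i k))\<^sup>2)))"
      by (intro sum.cong refl) (simp add: ch cmod_square_of_real mult_ac)
    also have "\<dots> = complex_of_real (\<Sum>k\<in>K. x k * p k)"
      by (subst sum.swap) (simp add: p sum_distrib_left)
    finally have "(\<Sum>i\<in>I. \<Sum>j\<in>J. Re (r i * c i j * X j i)) = (\<Sum>k\<in>K. x k * p k)"
      by (simp only: Re_complex_of_real flip: Re_sum)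
    then have lin: "(\<Sum>i\<in>I. \<Sum>j\<in>J. 2 * Re (r i * c i j * X j i)) = 2 * (\<Sum>k\<in>K. x k * p k)"
      by (simp only: sum_distrib_left[symmetric])
    have "(\<Sum>i\<in>I. \<Sum>j\<in>J. (s j + t * r i) * (cmod (X j i))\<^sup>2)
        = (\<Sum>j\<in>J. s j * (\<Sum>i\<in>I. (cmod (X j i))\<^sup>2)) + (\<Sum>i\<in>I. t * r i * (\<Sum>j\<in>J. (cmod (X j i))\<^sup>2))"
      unfolding distrib_right sum.distrib sum_distrib_left by (subst sum.swap) (rule refl)
    also have "\<dots> = (\<Sum>k\<in>K. (x k)\<^sup>2 * q k) + (\<Sum>k\<in>K. (x k)\<^sup>2 * (t * p k))"
      unfolding Xi Xj sum_distrib_left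
      by (subst (1 2) sum.swap) (simp add: p q sum_distrib_left mult_ac)
    finally have quad: "(\<Sum>i\<in>I. \<Sum>j\<in>J. (s j + t * r i) * (cmod (X j i))\<^sup>2) = (\<Sum>k\<in>K. (x k)\<^sup>2 * (q k + t * p k))"
      by (simp add: distrib_left sum.distrib)
    \<comment> \<open>Each parabola is evaluated at its vertex. If \<open>p k = 0\<close>, both
      sides are zero whatever the denominator is.\<close>
    have "(\<Sum>k\<in>K. p k * p k / (q k + t * p k)) = (\<Sum>k\<in>K. 2 * (x k * p k) - (x k)\<^sup>2 * (q k + t * p k))"
    proof (intro sum.cong refl)
      fix k assume k: "k \<in> K"
      have "p k = 0 \<or> q k + t * p k \<noteq> 0" using k t p0[of k] qpos[of k]
        by (metis add_pos_nonneg mult_nonneg_nonneg less_irrefl)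
      then show "p k * p k / (q k + t * p k) = 2 * (x k * p k) - (x k)\<^sup>2 * (q k + t * p k)"
        by (auto simp: x_def power2_eq_square divide_simps)
    qed
    also have "\<dots> = (\<Sum>i\<in>I. \<Sum>j\<in>J. 2 * Re (r i * c i j * X j i) - (s j + t * r i) * (cmod (X j i))\<^sup>2)"
      unfolding sum_subtractf lin quad by (simp add: sum_distrib_left)
    \<comment> \<open>The square is completed for each pair of indices separately; where the
      denominator vanishes, \<open>supp\<close> makes the numerator vanish too.\<close>
    also have "\<dots> \<le> (\<Sum>i\<in>I. \<Sum>j\<in>J. (cmod (r i * c i j))\<^sup>2 / (s j + t * r i))"
    proof (intro sum_mono complete_square_bound)
      fix i j assume ij: "i \<in> I" "j \<in> J"
      show "s j + t * r i \<ge> 0" using ij s r t by simp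
      show "complex_of_real (r i) * c i j = 0" if "s j + t * r i = 0"
      proof (rule ccontr)
        assume "complex_of_real (r i) * c i j \<noteq> 0"
        then have "s j > 0" using supp ij by simp
        moreover have "t * r i \<ge> 0" using ij r t by simp
        ultimately show False using that by linarith
      qed
    qed
    also have "\<dots> = (\<Sum>i\<in>I. \<Sum>j\<in>J. w i j * r i / (s j + t * r i))"
      by (intro sum.cong refl) (simp add: w_def norm_mult power_mult_distrib power2_eq_square mult_ac)
    finally show ?thesis by simp
  qed
  have G0: "G 0 \<le> G t" if "t \<ge> 0" for t
    using that deriv nonneg by (intro DERIV_nonneg_imp_nondecreasing[of 0 t G]) blast+
  \<comment> \<open>Both families of weights have total 1, so \<open>ln t\<close> can be subtracted
    inside both sums without changing \<open>G\<close>; this makes each sum converge at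
    infinity.\<close>
  have w1: "(\<Sum>i\<in>I. \<Sum>j\<in>J. w i j) = 1"
    using crow r1 by (simp only: w_def sum_distrib_left[symmetric] mult_1_right cong: sum.cong)
  have p1: "sum p K = 1"
  proof -
    have "sum p K = (\<Sum>i\<in>I. \<Sum>k\<in>K. r i * (cmod (h i k))\<^sup>2)"
      by (subst sum.swap) (simp add: p)
    then show ?thesis using hrow r1 by (simp only: sum_distrib_left[symmetric] mult_1_right cong: sum.cong)
  qed
  have "G t = (\<Sum>i\<in>I. \<Sum>j\<in>J. w i j * (ln (s j + t * r i) - ln t))
            - (\<Sum>k\<in>K. p k * (ln (q k + t * p k) - ln t))" for t
    using w1 p1 by (simp only: G_def right_diff_distrib sum_subtractf sum_distrib_right[symmetric])
  moreover have "((\<lambda>t. (\<Sum>i\<in>I. \<Sum>j\<in>J. w i j * (ln (s j + t * r i) - ln t))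
            - (\<Sum>k\<in>K. p k * (ln (q k + t * p k) - ln t)))
       \<longlongrightarrow> (\<Sum>i\<in>I. \<Sum>j\<in>J. w i j * ln (r i)) - (\<Sum>k\<in>K. p k * ln (p k))) at_top"
    by (intro tendsto_diff tendsto_sum tendsto_weighted_ln)
      (use wpos p0 in \<open>auto simp: order.strict_iff_order\<close>)
  ultimately have "(G \<longlongrightarrow> (\<Sum>i\<in>I. \<Sum>j\<in>J. w i j * ln (r i)) - (\<Sum>k\<in>K. p k * ln (p k))) at_top"
    by presburger
  then have "G 0 \<le> (\<Sum>i\<in>I. \<Sum>j\<in>J. w i j * ln (r i)) - (\<Sum>k\<in>K. p k * ln (p k))"
    by (rule tendsto_lowerbound) (use G0 in \<open>auto intro: eventually_mono[OF eventually_ge_at_top[of 0]]\<close>)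
  moreover have "(\<Sum>i\<in>I. \<Sum>j\<in>J. w i j * ln (r i)) = (\<Sum>i\<in>I. r i * ln (r i))"
    using crow by (simp only: w_def sum_distrib_left[symmetric] sum_distrib_right[symmetric] mult_1_right cong: sum.cong)
  ultimately show ?thesis by (simp add: G_def w_def)
qed

subsection \<open>Spectral theorem and matrix logarithm\<close>

lemma adj_carrier [simp]: "A \<in> carrier_mat n m \<Longrightarrow> adj A \<in> carrier_mat m n"
  by (auto simp: adj_def)

lemma adj_index [simp]: "i < dim_col A \<Longrightarrow> j < dim_row A \<Longrightarrow> adj A $$ (i,j) = cnj (A $$ (j,i))"
  by (simp add: adj_def)

lemma adj_dim [simp]: "dim_row (adj A) = dim_col A" "dim_col (adj A) = dim_row A"
  by (simp_all add: adj_def)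

lemma adj_adj [simp]: "adj (adj A) = A"
  by (intro eq_matI) auto

lemma mult_mat_index_sum:
  assumes "A \<in> carrier_mat n m" "B \<in> carrier_mat m k" "i < n" "j < k"
  shows "(A * B) $$ (i,j) = (\<Sum>l<m. A $$ (i,l) * B $$ (l,j))"
  using assms by (simp add: scalar_prod_def lessThan_atLeast0)

lemma adj_mult:
  assumes A: "A \<in> carrier_mat n m" and B: "B \<in> carrier_mat m k"
  shows "adj (A * B) = adj B * adj A"
proof (rule eq_matI)
  fix i j assume "i < dim_row (adj B * adj A)" "j < dim_col (adj B * adj A)"
  then have ij: "i < k" "j < n" using A B by auto
  have "adj (A * B) $$ (i,j) = cnj ((A * B) $$ (j,i))" using ij A B by simp
  also have "\<dots> = (\<Sum>l<m. adj B $$ (i,l) * adj A $$ (l,j))"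
    using ij A B by (subst mult_mat_index_sum[OF A B]) (auto simp: mult.commute)
  also have "\<dots> = (adj B * adj A) $$ (i,j)"
    using ij A B by (subst mult_mat_index_sum[of _ k m _ n]) auto
  finally show "adj (A * B) $$ (i,j) = (adj B * adj A) $$ (i,j)" .
qed (use A B in auto)

lemma adj_one [simp]: "adj (1\<^sub>m n) = 1\<^sub>m n"
  by (intro eq_matI) auto

lemma unitary_matD:
  assumes "unitary_mat n U"
  shows "U \<in> carrier_mat n n" "adj U \<in> carrier_mat n n" "adj U * U = 1\<^sub>m n" "U * adj U = 1\<^sub>m n"
  using assms by (auto simp: unitary_mat_def)

text \<open>For square matrices a left inverse is also a right inverse.\<close>

lemma unitary_matI:
  assumes "U \<in> carrier_mat n n" "adj U * U = 1\<^sub>m n"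
  shows "unitary_mat n U"
  using assms mat_mult_left_right_inverse[of "adj U" n U] by (simp add: unitary_mat_def)

lemma unitary_mat_adj: "unitary_mat n U \<Longrightarrow> unitary_mat n (adj U)"
  by (auto simp: unitary_mat_def)

lemmas square_mat_simps = assoc_mult_mat[of _ n n _ n _ n] mult_carrier_mat[of _ n n _ n]
  left_mult_one_mat[of _ n n] right_mult_one_mat[of _ n n] for n

lemma unitary_mat_mult:
  assumes U: "unitary_mat n U" and V: "unitary_mat n V"
  shows "unitary_mat n (U * V)"
proof (rule unitary_matI)
  note [simp] = unitary_matD[OF U] unitary_matD[OF V]
  show "U * V \<in> carrier_mat n n" by (rule mult_carrier_mat[of _ n n]) simp_all
  have "adj (U * V) * (U * V) = adj V * (adj U * U) * V"
    by (simp add: adj_mult[of U n n V n] square_mat_simps[where n = n]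
      del: unitary_matD(3,4)[OF U] unitary_matD(3,4)[OF V])
  then show "adj (U * V) * (U * V) = 1\<^sub>m n" by (simp add: square_mat_simps[where n = n])
qed

lemma unitary_mat_cols:
  assumes "unitary_mat n U" "i < n" "j < n"
  shows "(\<Sum>l<n. cnj (U $$ (l,i)) * U $$ (l,j)) = (if i = j then 1 else 0)"
proof -
  note Uc = unitary_matD[OF assms(1)]
  have "(adj U * U) $$ (i,j) = (\<Sum>l<n. cnj (U $$ (l,i)) * U $$ (l,j))"
    using assms(2,3) Uc(1) by (subst mult_mat_index_sum[of _ n n _ n]) auto
  then show ?thesis using assms(2,3) Uc(3) by simp
qed

lemma unitary_mat_rows:
  assumes "unitary_mat n U" "i < n" "j < n"
  shows "(\<Sum>l<n. U $$ (i,l) * cnj (U $$ (j,l))) = (if i = j then 1 else 0)"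
  using unitary_mat_cols[OF unitary_mat_adj[OF assms(1)] assms(2,3)] unitary_matD(1)[OF assms(1)] assms(2,3)
  by simp

text \<open>Complete \<open>v\<close> to a basis, orthogonalize by Gram-Schmidt, which keeps the
  first vector, and normalize. The factor \<open>z\<close> is the reciprocal of the norm of
  \<open>v\<close>.\<close>

lemma unitary_completion:
  fixes v :: "complex vec"
  assumes v: "v \<in> carrier_vec n" "v \<noteq> 0\<^sub>v n"
  obtains H z where "unitary_mat n H" "\<And>i. i < n \<Longrightarrow> H $$ (i,0) = z * vec_index v i"
proof -
  interpret cof_vec_space n "TYPE(complex)" .
  have n: "n \<noteq> 0" using v by auto
  let ?b = "basis_completion v"
  define ws where "ws = gram_schmidt n ?b"
  have b: "length ?b = n" "distinct ?b" "lin_indpt (set ?b)" "set ?b \<subseteq> carrier_vec n" "hd ?b = v"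
    using basis_completion[OF v] by auto
  have ws: "set ws \<subseteq> carrier_vec n" "corthogonal ws" "length ws = n"
    using gram_schmidt_result[OF b(4,2,3) ws_def] b(1) by auto
  obtain vs where vs: "?b = v # vs" using b n by (cases ?b) auto
  have "hd ws = v" using gram_schmidt_hd[of v vs] v vs ws_def by simp
  then have ws0: "ws ! 0 = v" using ws(3) n by (metis hd_conv_nth length_0_conv)
  \<comment> \<open>The vectors \<open>ws\<close> are only orthogonal, so each column is divided by
    its norm.\<close>
  define H where "H = mat n n (\<lambda>(i,j). vec_index (ws ! j) i / complex_of_real (sqrt (Re (ws ! j \<bullet>c ws ! j))))"
  have H: "H \<in> carrier_mat n n" by (simp add: H_def)
  have wsn: "ws ! j \<in> carrier_vec n" if "j < n" for j using ws that by auto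
  have "adj H * H = 1\<^sub>m n"
  proof (rule eq_matI)
    fix i j assume "i < dim_row (1\<^sub>m n)" "j < dim_col (1\<^sub>m n)"
    then have ij: "i < n" "j < n" by auto
    let ?d = "\<lambda>j. complex_of_real (sqrt (Re (ws ! j \<bullet>c ws ! j)))"
    have "(adj H * H) $$ (i,j) = (\<Sum>l<n. cnj (vec_index (ws ! i) l) * vec_index (ws ! j) l / (?d i * ?d j))"
      using ij H by (subst mult_mat_index_sum[of _ n n _ n]) (auto simp: H_def)
    also have "\<dots> = (ws ! j \<bullet>c ws ! i) / (?d i * ?d j)"
      using wsn[OF ij(1)] wsn[OF ij(2)]
      by (auto simp: scalar_prod_def sum_divide_distrib lessThan_atLeast0 mult.commute intro!: sum.cong)
    also have "\<dots> = (if i = j then 1 else 0)"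
    proof (cases "i = j")
      case True
      have ge: "ws ! i \<bullet>c ws ! i \<ge> 0" by (rule conjugate_square_ge_0_vec)
      moreover have "ws ! i \<bullet>c ws ! i \<noteq> 0" using ws(2,3) ij(1) by (simp add: corthogonal_def)
      ultimately have "Re (ws ! i \<bullet>c ws ! i) > 0" "ws ! i \<bullet>c ws ! i = complex_of_real (Re (ws ! i \<bullet>c ws ! i))"
        by (auto simp: less_eq_complex_def complex_eq_iff)
      moreover have "?d i * ?d i = complex_of_real (Re (ws ! i \<bullet>c ws ! i))"
        using \<open>Re (ws ! i \<bullet>c ws ! i) > 0\<close> by (simp flip: of_real_mult)
      ultimately show ?thesis using True by (metis \<open>ws ! i \<bullet>c ws ! i \<noteq> 0\<close> divide_self)
    next
      case False
      then show ?thesis using ws(2,3) ij by (simp add: corthogonal_def)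
    qed
    also have "\<dots> = 1\<^sub>m n $$ (i,j)" using ij by simp
    finally show "(adj H * H) $$ (i,j) = 1\<^sub>m n $$ (i,j)" .
  qed (use H in auto)
  then have "unitary_mat n H" using H by (intro unitary_matI)
  moreover have "H $$ (i,0) = (1 / complex_of_real (sqrt (Re (v \<bullet>c v)))) * vec_index v i" if "i < n" for i
    using that n by (simp add: H_def ws0)
  ultimately show ?thesis using that by blast
qed

section \<open>Diagonalization of Hermitian matrices by deflation\<close>

lemma adj_four_block_diag:
  assumes "A \<in> carrier_mat 1 1" "D \<in> carrier_mat n n"
  shows "adj (four_block_mat A (0\<^sub>m 1 n) (0\<^sub>m n 1) D) = four_block_mat (adj A) (0\<^sub>m 1 n) (0\<^sub>m n 1) (adj D)"
  using assms by (intro eq_matI) auto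

lemma mult_four_block_diag:
  assumes "A \<in> carrier_mat 1 1" "D \<in> carrier_mat n n" "A' \<in> carrier_mat 1 1" "D' \<in> carrier_mat n n"
  shows "four_block_mat A (0\<^sub>m 1 n) (0\<^sub>m n 1) D * four_block_mat A' (0\<^sub>m 1 n) (0\<^sub>m n 1) D'
       = four_block_mat (A * A') (0\<^sub>m 1 n) (0\<^sub>m n 1) (D * D' :: complex mat)"
  using assms by (subst mult_four_block_mat[of _ 1 1 _ n _ n _ _ 1 _ n])
    (auto intro!: cong_four_block_mat)

text \<open>Complete an eigenvector of \<open>A\<close> to a unitary \<open>H\<close>. Conjugating
  by \<open>H\<close> splits off a block of size one, and the induction hypothesis diagonalizes the
  Hermitian remainder.\<close>

theorem hermitian_diagonalization:
  fixes A :: "complex mat"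
  assumes "A \<in> carrier_mat n n" "adj A = A"
  shows "\<exists>U d. unitary_mat n U \<and> A = U * mat_diag n (\<lambda>i. complex_of_real (d i)) * adj U"
  using assms
proof (induction n arbitrary: A)
  case 0
  then show ?case
    by (intro exI[of _ "1\<^sub>m 0"] exI[of _ "\<lambda>_. 0"]) (auto simp: unitary_mat_def)
next
  case (Suc n A)
  note A = Suc.prems(1)
  obtain e v where v: "v \<in> carrier_vec (Suc n)" "v \<noteq> 0\<^sub>v (Suc n)" "A *\<^sub>v v = e \<cdot>\<^sub>v v"
    using spectrum_non_empty[OF A] A by (auto simp: spectrum_def eigenvalue_def eigenvector_def)
  obtain H z where H: "unitary_mat (Suc n) H"
    and H0: "\<And>i. i < Suc n \<Longrightarrow> H $$ (i,0) = z * vec_index v i"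
    using unitary_completion[OF v(1,2)] by blast
  note Hc = unitary_matD[OF H]
  define B where "B = adj H * (A * H)"
  have AH: "A * H \<in> carrier_mat (Suc n) (Suc n)" using A Hc(1) by (rule mult_carrier_mat)
  have B: "B \<in> carrier_mat (Suc n) (Suc n)" using AH Hc(2) unfolding B_def by (rule mult_carrier_mat[rotated])
  have adjB: "adj B = B"
    using A Hc Suc.prems(2) AH unfolding B_def
    by (simp add: adj_mult[of _ "Suc n" "Suc n" _ "Suc n"] square_mat_simps[where n = "Suc n"])
  \<comment> \<open>Column 0 of \<open>H\<close> is a multiple of the eigenvector, so
    \<open>A\<close> only scales it.\<close>
  have AH0: "(A * H) $$ (k,0) = e * H $$ (k,0)" if k: "k < Suc n" for k
  proof -
    have "(A * H) $$ (k,0) = z * (\<Sum>l<Suc n. A $$ (k,l) * vec_index v l)"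
      using k A Hc(1) by (subst mult_mat_index_sum[of _ "Suc n" "Suc n" _ "Suc n"])
        (auto simp: H0 sum_distrib_left algebra_simps simp del: sum.lessThan_Suc)
    also have "(\<Sum>l<Suc n. A $$ (k,l) * vec_index v l) = vec_index (A *\<^sub>v v) k"
      using k A v(1) by (auto simp: scalar_prod_def lessThan_atLeast0 simp del: sum.lessThan_Suc sum.op_ivl_Suc)
    finally show ?thesis using k v by (simp add: H0)
  qed
  have B0: "B $$ (i,0) = (if i = 0 then e else 0)" if i: "i < Suc n" for i
  proof -
    have "B $$ (i,0) = (\<Sum>l<Suc n. e * (cnj (H $$ (l,i)) * H $$ (l,0)))"
      unfolding B_def using i Hc(1) AH
      by (subst mult_mat_index_sum[of _ "Suc n" "Suc n" _ "Suc n"])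
        (auto simp: AH0 simp del: sum.lessThan_Suc intro!: sum.cong)
    also have "\<dots> = e * (if i = 0 then 1 else 0)"
      using unitary_mat_cols[OF H i, of 0] by (simp only: sum_distrib_left[symmetric])
    finally show ?thesis by simp
  qed
  have Bsym: "B $$ (i,j) = cnj (B $$ (j,i))" if "i < Suc n" "j < Suc n" for i j
    using adj_index[of i B j] B that by (simp add: adjB)
  have e: "e = complex_of_real (Re e)"
    using Bsym[of 0 0] B0[of 0] by (simp add: complex_eq_iff)
  define A' where "A' = mat n n (\<lambda>(i,j). B $$ (Suc i, Suc j))"
  have A': "A' \<in> carrier_mat n n" by (simp add: A'_def)
  have "adj A' = A'"
    by (intro eq_matI) (auto simp: A'_def Bsym[symmetric])
  then obtain U d where U: "unitary_mat n U" and A'U: "A' = U * mat_diag n (\<lambda>i. complex_of_real (d i)) * adj U"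
    using Suc.IH[OF A'] by blast
  note Uc = unitary_matD[OF U]
  \<comment> \<open>\<open>V\<close> leaves the split-off direction fixed and acts as
    \<open>U\<close> on the rest; \<open>d'\<close> puts the new eigenvalue in front of the old
    ones.\<close>
  define V where "V = four_block_mat (1\<^sub>m 1) (0\<^sub>m 1 n) (0\<^sub>m n 1) U"
  define d' where "d' i = (case i of 0 \<Rightarrow> Re e | Suc i \<Rightarrow> d i)" for i
  let ?D = "mat_diag n (\<lambda>i. complex_of_real (d i))"
  let ?D' = "mat_diag (Suc n) (\<lambda>i. complex_of_real (d' i))"
  have Vc: "V \<in> carrier_mat (Suc n) (Suc n)"
    using four_block_carrier_mat[of "1\<^sub>m 1" 1 1 U n n] Uc by (simp add: V_def)
  have adjV: "adj V = four_block_mat (1\<^sub>m 1) (0\<^sub>m 1 n) (0\<^sub>m n 1) (adj U)"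
    using Uc adj_four_block_diag[of "1\<^sub>m 1" U n] by (simp add: V_def)
  have V: "unitary_mat (Suc n) V"
    using Vc
  proof (rule unitary_matI)
    have "adj V * V = four_block_mat (1\<^sub>m 1) (0\<^sub>m 1 n) (0\<^sub>m n 1) (1\<^sub>m n)"
      unfolding adjV unfolding V_def using Uc by (subst mult_four_block_diag) auto
    then show "adj V * V = 1\<^sub>m (Suc n)" by simp
  qed
  have D': "?D' = four_block_mat (mat 1 1 (\<lambda>_. e)) (0\<^sub>m 1 n) (0\<^sub>m n 1) ?D"
    using e by (intro eq_matI) (auto simp: mat_diag_def d'_def split: nat.splits)
  \<comment> \<open>The first column is known from \<open>B0\<close>; Hermitian symmetry then clears
    the first row.\<close>
  have "B = four_block_mat (mat 1 1 (\<lambda>_. e)) (0\<^sub>m 1 n) (0\<^sub>m n 1) A'"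
  proof (rule eq_matI)
    fix i j
    assume "i < dim_row (four_block_mat (mat 1 1 (\<lambda>_. e)) (0\<^sub>m 1 n) (0\<^sub>m n 1) A')"
      "j < dim_col (four_block_mat (mat 1 1 (\<lambda>_. e)) (0\<^sub>m 1 n) (0\<^sub>m n 1) A')"
    then have ij: "i < Suc n" "j < Suc n" by (auto simp: A'_def)
    then show "B $$ (i,j) = four_block_mat (mat 1 1 (\<lambda>_. e)) (0\<^sub>m 1 n) (0\<^sub>m n 1) A' $$ (i,j)"
      using B0[OF ij(1)] B0[OF ij(2)] Bsym[OF ij] by (cases i; cases j) (auto simp: A'_def)
  qed (use B in \<open>auto simp: A'_def\<close>)
  also have "\<dots> = V * ?D' * adj V"
  proof -
    have "V * ?D' = four_block_mat (mat 1 1 (\<lambda>_. e)) (0\<^sub>m 1 n) (0\<^sub>m n 1) (U * ?D)"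
      unfolding V_def D' using Uc by (subst mult_four_block_diag) auto
    then show ?thesis
      unfolding A'U adjV using Uc by (simp only:) (subst mult_four_block_diag, auto)
  qed
  finally have BV: "B = V * ?D' * adj V" .
  have "A = (H * adj H) * A * (H * adj H)" using Hc A by simp
  also have "\<dots> = H * B * adj H"
    using Hc(1,2) A by (simp add: B_def square_mat_simps[where n = "Suc n"])
  also have "\<dots> = (H * V) * ?D' * adj (H * V)"
    unfolding BV using Hc(1,2) Vc
    by (simp add: adj_mult[of H "Suc n" "Suc n" V "Suc n"] square_mat_simps[where n = "Suc n"])
  finally show ?case using unitary_mat_mult[OF H V] by blast
qed

text \<open>The change of basis \<open>C = adj V * U\<close> only links equal eigenvalues.\<close>
lemma functional_calculus_unique:
  fixes f :: "real \<Rightarrow> real"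
  assumes U: "unitary_mat n U" and V: "unitary_mat n V"
    and eq: "U * mat_diag n (\<lambda>i. complex_of_real (d i)) * adj U = V * mat_diag n (\<lambda>i. complex_of_real (d' i)) * adj V"
  shows "U * mat_diag n (\<lambda>i. complex_of_real (f (d i))) * adj U = V * mat_diag n (\<lambda>i. complex_of_real (f (d' i))) * adj V"
proof -
  note Uc = unitary_matD[OF U] and Vc = unitary_matD[OF V]
  note [simp] = square_mat_simps[where n = n] Uc(1,2) Vc(1,2)
  define C where "C = adj V * U"
  have C: "C \<in> carrier_mat n n" by (simp add: C_def)
  let ?D = "\<lambda>d. mat_diag n (\<lambda>i. complex_of_real (d i))"
  have "C * ?D d = adj V * (U * ?D d * adj U) * U"
    using Uc(3) by (simp add: C_def)
  also have "\<dots> = (adj V * V) * ?D d' * C"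
    unfolding eq by (simp add: C_def)
  finally have CD: "C * ?D d = ?D d' * C" using Vc(3) C by simp
  have "C * ?D (\<lambda>i. f (d i)) = ?D (\<lambda>i. f (d' i)) * C"
  proof (rule eq_matI)
    fix i j assume "i < dim_row (?D (\<lambda>i. f (d' i)) * C)" "j < dim_col (?D (\<lambda>i. f (d' i)) * C)"
    then have ij: "i < n" "j < n" using C by (auto simp: mat_diag_def)
    have "C $$ (i,j) * complex_of_real (d j) = complex_of_real (d' i) * C $$ (i,j)"
      using arg_cong[OF CD, of "\<lambda>M. M $$ (i,j)"] ij C
      by (simp add: mat_diag_mult_left[of _ n n] mat_diag_mult_right[of _ n n])
    then have "C $$ (i,j) = 0 \<or> d j = d' i" by (simp add: mult.commute)
    then show "(C * ?D (\<lambda>i. f (d i))) $$ (i,j) = (?D (\<lambda>i. f (d' i)) * C) $$ (i,j)"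
      using ij C by (auto simp: mat_diag_mult_left[of _ n n] mat_diag_mult_right[of _ n n])
  qed (use C in \<open>auto simp: mat_diag_def\<close>)
  then have "V * (C * ?D (\<lambda>i. f (d i))) * adj U = V * (?D (\<lambda>i. f (d' i)) * C) * adj U" by simp
  moreover have "V * (C * ?D (\<lambda>i. f (d i))) * adj U = (V * adj V) * U * ?D (\<lambda>i. f (d i)) * adj U"
    by (simp add: C_def)
  moreover have "V * (?D (\<lambda>i. f (d' i)) * C) * adj U = V * ?D (\<lambda>i. f (d' i)) * adj V * (U * adj U)"
    by (simp add: C_def)
  ultimately show ?thesis using Uc(4) Vc(4) by simp
qed

text \<open>By uniqueness of the functional calculus every diagonalization yields the same matrix,
  so the \<open>SOME\<close> in \<open>mat_log2\<close> may be evaluated with any of them.\<close>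

lemma mat_log2_eq:
  assumes U: "unitary_mat n U" and A: "A = U * mat_diag n (\<lambda>i. complex_of_real (d i)) * adj U"
  shows "mat_log2 A = U * mat_diag n (\<lambda>i. complex_of_real (log2' (d i))) * adj U"
proof -
  have n: "dim_row A = n" using A unitary_matD(1)[OF U] by simp
  show ?thesis unfolding mat_log2_def n
  proof (rule someI2_ex)
    show "\<exists>L U d. unitary_mat n U \<and> A = U * mat_diag n (\<lambda>i. complex_of_real (d i)) * adj U
        \<and> L = U * mat_diag n (\<lambda>i. complex_of_real (log2' (d i))) * adj U"
      using U A by blast
  next
    fix L assume "\<exists>U d. unitary_mat n U \<and> A = U * mat_diag n (\<lambda>i. complex_of_real (d i)) * adj U
        \<and> L = U * mat_diag n (\<lambda>i. complex_of_real (log2' (d i))) * adj U"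
    then show "L = U * mat_diag n (\<lambda>i. complex_of_real (log2' (d i))) * adj U"
      using functional_calculus_unique[OF _ U] A by metis
  qed
qed

section \<open>Relative entropy in terms of eigenvalues and outcome probabilities\<close>

lemma tr_mult_commute:
  assumes "A \<in> carrier_mat n m" "B \<in> carrier_mat m n"
  shows "tr (A * B) = tr (B * A)"
proof -
  have "tr (A * B) = (\<Sum>i<n. \<Sum>l<m. A $$ (i,l) * B $$ (l,i))"
    using assms by (simp add: tr_def scalar_prod_def lessThan_atLeast0)
  also have "\<dots> = tr (B * A)"
    using assms by (subst sum.swap) (simp add: tr_def scalar_prod_def lessThan_atLeast0 mult.commute)
  finally show ?thesis .
qed

text \<open>For a density operator \<open>A\<close> and unitary \<open>Y\<close> this is the
  probability of outcome \<open>k\<close> when measuring in the basis of columns of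
  \<open>Y\<close>. The diagonal entry is already real for Hermitian \<open>A\<close>;
  \<open>Re\<close> only fixes the type.\<close>

definition basis_prob :: "complex mat \<Rightarrow> complex mat \<Rightarrow> nat \<Rightarrow> real" where
  "basis_prob Y A k = Re ((adj Y * A * Y) $$ (k,k))"

text \<open>Cyclicity of the trace moves \<open>adj Y\<close> to the front; against a diagonal
  matrix only the diagonal of \<open>adj Y * A * Y\<close> counts.\<close>

lemma tr_mult_diagonalized:
  assumes A: "A \<in> carrier_mat n n" and Y: "Y \<in> carrier_mat n n"
  shows "Re (tr (A * (Y * mat_diag n (\<lambda>i. complex_of_real (q i)) * adj Y))) = (\<Sum>k<n. basis_prob Y A k * q k)"
proof -
  let ?D = "mat_diag n (\<lambda>i. complex_of_real (q i))"
  note [simp] = square_mat_simps[where n = n] A Y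
  have "tr (A * (Y * ?D * adj Y)) = tr ((A * Y * ?D) * adj Y)" by simp
  also have "\<dots> = tr (adj Y * (A * Y * ?D))"
    by (rule tr_mult_commute[of _ n n]) simp_all
  also have "\<dots> = tr ((adj Y * A * Y) * ?D)" by simp
  also have "\<dots> = (\<Sum>k<n. (adj Y * A * Y) $$ (k,k) * q k)"
    by (subst mat_diag_mult_right[of _ n n]) (simp_all add: tr_def)
  finally show ?thesis by (simp add: basis_prob_def)
qed

lemma basis_prob_eigenbasis:
  assumes U: "unitary_mat n U" and A: "A = U * mat_diag n (\<lambda>i. complex_of_real (d i)) * adj U" and "k < n"
  shows "basis_prob U A k = d k"
proof -
  note Uc = unitary_matD[OF U]
  note [simp] = square_mat_simps[where n = n] Uc(1,2)
  have "adj U * A * U = (adj U * U) * mat_diag n (\<lambda>i. complex_of_real (d i)) * (adj U * U)"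
    unfolding A by simp
  then have "adj U * A * U = mat_diag n (\<lambda>i. complex_of_real (d i))" using Uc(3) by simp
  then show ?thesis using \<open>k < n\<close> by (simp add: basis_prob_def mat_diag_def)
qed

text \<open>If \<open>B\<close> is \<open>A\<close> dephased in the basis \<open>Y\<close>, then
  \<open>q\<close> is \<open>basis_prob Y A\<close> and the formula becomes a difference of two
  entropies.\<close>

lemma rel_entropy_diagonalized:
  assumes U: "unitary_mat n U" and A: "A = U * mat_diag n (\<lambda>i. complex_of_real (r i)) * adj U"
    and Y: "unitary_mat n Y" and B: "B = Y * mat_diag n (\<lambda>i. complex_of_real (q i)) * adj Y"
  shows "rel_entropy A B = (\<Sum>i<n. r i * log2' (r i)) - (\<Sum>k<n. basis_prob Y A k * log2' (q k))"
proof -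
  note Uc = unitary_matD[OF U] and Yc = unitary_matD[OF Y]
  have Ac: "A \<in> carrier_mat n n" using Uc by (simp add: A mult_carrier_mat[of _ n n _ n])
  have tr_minus: "tr (M - M') = tr M - tr M'" if "M \<in> carrier_mat n n" "M' \<in> carrier_mat n n" for M M'
    using that by (simp add: tr_def sum_subtractf)
  show ?thesis
    unfolding rel_entropy_def mat_log2_eq[OF U A] mat_log2_eq[OF Y B]
    using Uc Yc Ac basis_prob_eigenbasis[OF U A]
    by (subst tr_minus)
      (simp_all add: mult_carrier_mat[of _ n n _ n] tr_mult_diagonalized)
qed

subsection \<open>Rank-one projective measurements\<close>

lemma span_singletonD:
  assumes "v \<in> carrier_vec n" "x \<in> LinearCombinations.module.span class_ring (module_vec TYPE(complex) n) {v}"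
  shows "\<exists>c. x = c \<cdot>\<^sub>v v"
proof -
  interpret vec_space "TYPE(complex)" n .
  obtain a where "x = lincomb a {v}" using assms finite_span[of "{v}"] by auto
  then show ?thesis using assms(1) by (auto simp: lincomb_def)
qed

lemma rank_ge_1:
  fixes A :: "complex mat"
  assumes A: "A \<in> carrier_mat n n" and ij: "i < n" "j < n" "A $$ (i,j) \<noteq> 0"
  shows "vec_space.rank n A \<ge> 1"
proof -
  interpret vec_space "TYPE(complex)" n .
  have c: "col A j \<in> carrier_vec n" using A ij by auto
  have "col A j \<in> set (cols A)" using A ij by (auto simp: cols_def)
  moreover have "lin_indpt {col A j}"
  proof
    assume "lin_dep {col A j}"
    then have "col A j \<in> span {}" using lindep_span[of "{col A j}"] c by auto
    then have "col A j = 0\<^sub>v n" by (simp add: span_empty)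
    then have "vec_index (col A j) i = 0" using ij by simp
    then show False using A ij by simp
  qed
  ultimately show ?thesis using rank_ge_card_indpt[OF A, of "{col A j}"] by simp
qed

text \<open>Two distinct columns are linearly dependent, so every column is a multiple of one fixed
  column with a nonzero entry.\<close>

lemma rank_1_imp_product:
  fixes A :: "complex mat"
  assumes A: "A \<in> carrier_mat n n" and r: "vec_space.rank n A = 1"
  obtains v w i0 j0 where "\<And>i j. i < n \<Longrightarrow> j < n \<Longrightarrow> A $$ (i,j) = v i * w j"
    "i0 < n" "j0 < n" "A $$ (i0,j0) \<noteq> 0"
proof -
  interpret vec_space "TYPE(complex)" n .
  obtain i0 j0 where ij0: "i0 < n" "j0 < n" "A $$ (i0,j0) \<noteq> 0"
  proof (rule ccontr)
    assume "\<not> thesis"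
    then have "A = 0\<^sub>m n n" using A that by (intro eq_matI) auto
    then show False using r rank_0I[of n] by simp
  qed
  let ?v = "col A j0"
  have v: "?v \<in> carrier_vec n" "?v \<in> set (cols A)" using A ij0 by (auto simp: cols_def)
  have v0: "vec_index ?v i0 \<noteq> 0" using A ij0 by simp
  have "\<exists>c. col A j = c \<cdot>\<^sub>v ?v" if j: "j < n" for j
  \<comment> \<open>Equal columns form a one-element set, to which the cardinality bound from the
    rank gives no contradiction; hence the separate case.\<close>
  proof (cases "col A j = ?v")
    case True
    then show ?thesis by (metis one_smult_vec)
  next
    case False
    have w: "col A j \<in> carrier_vec n" "col A j \<in> set (cols A)" using A j by (auto simp: cols_def)
    have "lin_dep {?v, col A j}"
    proof (rule ccontr)
      assume "\<not> lin_dep {?v, col A j}"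
      then have "card {?v, col A j} \<le> 1"
        using rank_ge_card_indpt[OF A, of "{?v, col A j}"] v w r by simp
      then show False using False by simp
    qed
    then obtain u where u: "u \<in> {?v, col A j}" "u \<in> span ({?v, col A j} - {u})"
      using lindep_span[of "{?v, col A j}"] v w by (meson empty_subsetI finite.emptyI finite.insertI insert_subset)
    show ?thesis
    proof (cases "u = ?v")
      \<comment> \<open>The relation expresses the fixed column through column \<open>j\<close>. Its
        coefficient is nonzero because the entry at \<open>i0\<close> is, so the relation can be
        inverted.\<close>
      case True
      then have "?v \<in> span {col A j}" using u False by (simp add: insert_Diff_if)
      then obtain c where c: "?v = c \<cdot>\<^sub>v col A j" using span_singletonD[OF w(1)] by blast
      have "c \<noteq> 0" using v0 arg_cong[OF c, of "\<lambda>x. vec_index x i0"] w ij0 A by auto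
      then have "col A j = (1 / c) \<cdot>\<^sub>v ?v" by (subst c) (simp add: smult_smult_assoc)
      then show ?thesis by blast
    next
      case F: False
      then have "col A j \<in> span {?v}" using u False by (auto simp: insert_Diff_if)
      then show ?thesis using span_singletonD[OF v(1)] by blast
    qed
  qed
  then obtain c where c: "\<And>j. j < n \<Longrightarrow> col A j = c j \<cdot>\<^sub>v ?v" by metis
  have "A $$ (i,j) = A $$ (i,j0) * c j" if "i < n" "j < n" for i j
    using arg_cong[OF c[OF that(2)], of "\<lambda>x. vec_index x i"] that A ij0 by simp
  then show ?thesis using that[of "\<lambda>i. A $$ (i,j0)" c i0 j0] ij0 by blast
qed

text \<open>Substituting a product form \<open>v i * w j\<close> into P = P \<open>adj P\<close>
  replaces \<open>w\<close> by the conjugate of \<open>v\<close> times the squared norm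
  \<open>s\<close> of \<open>w\<close>; the root of \<open>s\<close> is absorbed into
  \<open>u\<close>. Idempotence at a nonzero entry then gives norm 1.\<close>

lemma rank_one_projector_outer:
  fixes P :: "complex mat"
  assumes P: "P \<in> carrier_mat n n" and idem: "P * P = P" and herm: "adj P = P"
    and r: "vec_space.rank n P = 1"
  obtains u where "\<And>i j. i < n \<Longrightarrow> j < n \<Longrightarrow> P $$ (i,j) = u i * cnj (u j)"
    "(\<Sum>l<n. cnj (u l) * u l) = 1"
proof -
  obtain v w i0 j0 where vw: "\<And>i j. i < n \<Longrightarrow> j < n \<Longrightarrow> P $$ (i,j) = v i * w j"
    and ij0: "i0 < n" "j0 < n" "P $$ (i0,j0) \<noteq> 0"
    using rank_1_imp_product[OF P r] by metis
  define s where "s = (\<Sum>k<n. (cmod (w k))\<^sup>2)"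
  define u where "u i = complex_of_real (sqrt s) * v i" for i
  have s: "s \<ge> 0" by (simp add: s_def sum_nonneg)
  have Pu: "P $$ (i,j) = u i * cnj (u j)" if ij: "i < n" "j < n" for i j
  proof -
    have "P $$ (i,j) = (\<Sum>k<n. P $$ (i,k) * P $$ (k,j))"
      using mult_mat_index_sum[OF P P ij] idem by simp
    also have "\<dots> = (\<Sum>k<n. P $$ (i,k) * cnj (P $$ (j,k)))"
    proof (intro sum.cong refl arg_cong2[of _ _ _ _ "(*)"])
      fix k assume "k \<in> {..<n}"
      then show "P $$ (k,j) = cnj (P $$ (j,k))" using adj_index[of k P j] P ij herm by simp
    qed
    also have "\<dots> = (\<Sum>k<n. v i * cnj (v j) * complex_of_real ((cmod (w k))\<^sup>2))"
      unfolding complex_norm_square using ij by (intro sum.cong refl) (simp add: vw algebra_simps)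
    also have "\<dots> = v i * cnj (v j) * complex_of_real s"
      by (simp add: s_def sum_distrib_left)
    also have "complex_of_real s = complex_of_real (sqrt s) * complex_of_real (sqrt s)"
      using s by (simp flip: of_real_mult)
    finally show ?thesis by (simp add: u_def algebra_simps)
  qed
  have "P $$ (i0,j0) = (\<Sum>k<n. P $$ (i0,k) * P $$ (k,j0))"
    using mult_mat_index_sum[OF P P ij0(1,2)] idem by simp
  also have "\<dots> = (\<Sum>k<n. P $$ (i0,j0) * (cnj (u k) * u k))"
    using ij0 by (intro sum.cong refl) (simp add: Pu)
  also have "\<dots> = P $$ (i0,j0) * (\<Sum>k<n. cnj (u k) * u k)" by (simp add: sum_distrib_left)
  finally have "(\<Sum>k<n. cnj (u k) * u k) = 1" using ij0(3) by simp
  then show ?thesis using that Pu by blast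
qed

text \<open>Each projector comes from a unit vector; orthogonality of the projectors makes these
  vectors orthonormal, and completeness fixes their number, so they are the columns of a unitary
  matrix.\<close>

lemma rank_one_pvm_unitary:
  assumes "rank_one_pvm n m P"
  obtains Y where "m = n" "unitary_mat n Y"
    "\<And>k i j. k < n \<Longrightarrow> i < n \<Longrightarrow> j < n \<Longrightarrow> P k $$ (i,j) = Y $$ (i,k) * cnj (Y $$ (j,k))"
proof -
  have P: "P k \<in> carrier_mat n n" "P k * P k = P k" "adj (P k) = P k" "vec_space.rank n (P k) = 1"
    if "k < m" for k using assms that by (auto simp: rank_one_pvm_def)
  have orth: "P k * P l = 0\<^sub>m n n" if "k < m" "l < m" "k \<noteq> l" for k l
    using assms that by (auto simp: rank_one_pvm_def)
  have complete: "(\<Sum>k<m. P k $$ (i,j)) = (if i = j then 1 else 0)" if "i < n" "j < n" for i j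
  proof -
    have "mat n n (\<lambda>(i,j). \<Sum>k<m. P k $$ (i,j)) $$ (i,j) = 1\<^sub>m n $$ (i,j)"
      using assms by (simp add: rank_one_pvm_def)
    then show ?thesis using that by simp
  qed
  have "\<exists>u. (\<forall>i<n. \<forall>j<n. P k $$ (i,j) = u i * cnj (u j)) \<and> (\<Sum>l<n. cnj (u l) * u l) = 1" if "k < m" for k
    using rank_one_projector_outer[OF P[OF that]] by metis
  then obtain u where u: "\<And>k i j. k < m \<Longrightarrow> i < n \<Longrightarrow> j < n \<Longrightarrow> P k $$ (i,j) = u k i * cnj (u k j)"
    and u1: "\<And>k. k < m \<Longrightarrow> (\<Sum>l<n. cnj (u k l) * u k l) = 1" by metis
  have u0: "(\<Sum>x<n. cnj (u k x) * u l x) = 0" if kl: "k < m" "l < m" "k \<noteq> l" for k l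
  proof -
    have "\<exists>i<n. u k i \<noteq> 0" if "k < m" for k
    proof (rule ccontr)
      assume "\<not> (\<exists>i<n. u k i \<noteq> 0)"
      then have "(\<Sum>l<n. cnj (u k l) * u k l) = 0" by (intro sum.neutral) auto
      then show False using u1[OF that] by simp
    qed
    \<comment> \<open>At an entry where both outer factors are nonzero, the vanishing product
      isolates the inner product of the two vectors.\<close>
    then obtain i j where ij: "i < n" "u k i \<noteq> 0" "j < n" "u l j \<noteq> 0" using kl by metis
    have "0 = (P k * P l) $$ (i,j)" using orth[OF kl] ij by simp
    also have "\<dots> = (\<Sum>x<n. P k $$ (i,x) * P l $$ (x,j))"
      using mult_mat_index_sum[of "P k" n n "P l" n i j] P kl ij by simp
    also have "\<dots> = (\<Sum>x<n. u k i * cnj (u l j) * (cnj (u k x) * u l x))"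
      using kl ij by (intro sum.cong refl) (simp add: u)
    also have "\<dots> = u k i * cnj (u l j) * (\<Sum>x<n. cnj (u k x) * u l x)" by (simp add: sum_distrib_left)
    finally show ?thesis using ij by simp
  qed
  \<comment> \<open>Taking the trace of the completeness relation counts the projectors, since each
    has trace 1.\<close>
  have "(of_nat n :: complex) = (\<Sum>i<n. \<Sum>k<m. P k $$ (i,i))" by (simp add: complete)
  also have "\<dots> = (\<Sum>k<m. \<Sum>i<n. cnj (u k i) * u k i)"
    by (subst sum.swap) (simp add: u mult.commute)
  also have "\<dots> = of_nat m" by (simp add: u1)
  finally have mn: "m = n" by (simp only: of_nat_eq_iff)
  define Y where "Y = mat n n (\<lambda>(i,k). u k i)"
  have Y: "Y \<in> carrier_mat n n" by (simp add: Y_def)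
  have "adj Y * Y = 1\<^sub>m n"
  proof (rule eq_matI)
    fix k l assume "k < dim_row (1\<^sub>m n)" "l < dim_col (1\<^sub>m n)"
    then have kl: "k < n" "l < n" by auto
    have "(adj Y * Y) $$ (k,l) = (\<Sum>x<n. cnj (u k x) * u l x)"
      using kl Y by (subst mult_mat_index_sum[of _ n n _ n]) (auto simp: Y_def)
    then show "(adj Y * Y) $$ (k,l) = 1\<^sub>m n $$ (k,l)"
      using kl u0[of k l] u1[of k] mn by (cases "k = l") auto
  qed (use Y in auto)
  then have "unitary_mat n Y" using Y by (intro unitary_matI)
  moreover have "P k $$ (i,j) = Y $$ (i,k) * cnj (Y $$ (j,k))" if "k < n" "i < n" "j < n" for k i j
    using that mn by (simp add: u Y_def)
  ultimately show ?thesis using that mn by blast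
qed

text \<open>The projectors onto the standard basis; their existence keeps the set inside the
  \<open>Inf\<close> of \<open>gamma_discord\<close> nonempty.\<close>

lemma standard_rank_one_pvm: "\<exists>m P. rank_one_pvm n m P"
proof (intro exI)
  define P :: "nat \<Rightarrow> complex mat" where "P k = mat n n (\<lambda>(i,j). if i = k \<and> j = k then 1 else 0)" for k
  have P: "P k \<in> carrier_mat n n" for k by (simp add: P_def)
  have mult: "P k * P l = (if k = l then P k else 0\<^sub>m n n)" if "k < n" for k l
  proof (rule eq_matI)
    fix i j assume "i < dim_row (if k = l then P k else 0\<^sub>m n n)" "j < dim_col (if k = l then P k else 0\<^sub>m n n)"
    then have ij: "i < n" "j < n" using carrier_matD[OF P[of k]] by (auto split: if_splits)
    have "(P k * P l) $$ (i,j) = (\<Sum>x<n. P k $$ (i,x) * P l $$ (x,j))"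
      using mult_mat_index_sum[OF P P ij] .
    also have "\<dots> = (\<Sum>x<n. if x = k then (if i = k \<and> k = l \<and> j = l then 1 else 0) else 0)"
      using ij by (intro sum.cong refl) (auto simp: P_def)
    also have "\<dots> = (if k = l then P k else 0\<^sub>m n n) $$ (i,j)"
      using ij that by (auto simp: P_def)
    finally show "(P k * P l) $$ (i,j) = (if k = l then P k else 0\<^sub>m n n) $$ (i,j)" .
  qed (use carrier_matD[OF P] in auto)
  have "vec_space.rank n (P k) = 1" if "k < n" for k
  proof (rule antisym)
    show "vec_space.rank n (P k) \<le> 1"
      by (rule vec_space.rank_le_1_product_entries[OF P, of k "\<lambda>i. if i = k then 1 else 0" "\<lambda>j. if j = k then 1 else 0"])
        (auto simp: P_def)
    show "1 \<le> vec_space.rank n (P k)"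
      by (rule rank_ge_1[OF P that that]) (use that in \<open>simp add: P_def\<close>)
  qed
  moreover have "adj (P k) = P k" for k by (intro eq_matI) (auto simp: P_def)
  moreover have "mat n n (\<lambda>(i,j). \<Sum>k<n. P k $$ (i,j)) = 1\<^sub>m n"
  proof (intro eq_matI)
    fix i j assume "i < dim_row (1\<^sub>m n)" "j < dim_col (1\<^sub>m n)"
    then have ij: "i < n" "j < n" by auto
    then have "(\<Sum>k<n. P k $$ (i,j)) = (\<Sum>k<n. if k = i then (if i = j then 1 else 0) else 0)"
      by (intro sum.cong refl) (auto simp: P_def)
    then show "mat n n (\<lambda>(i,j). \<Sum>k<n. P k $$ (i,j)) $$ (i,j) = 1\<^sub>m n $$ (i,j)" using ij by simp
  qed auto
  ultimately show "rank_one_pvm n n P" using P mult by (auto simp: rank_one_pvm_def)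
qed

section \<open>Dephasing in an orthonormal basis\<close>

lemma sandwich_index:
  assumes A: "A \<in> carrier_mat n n" and B: "B \<in> carrier_mat n n" and C: "C \<in> carrier_mat n n"
    and ij: "i < n" "j < n"
  shows "(A * B * C) $$ (i,j) = (\<Sum>x<n. \<Sum>y<n. A $$ (i,x) * B $$ (x,y) * C $$ (y,j))"
proof -
  have "(A * B * C) $$ (i,j) = (\<Sum>y<n. (A * B) $$ (i,y) * C $$ (y,j))"
    using A B C ij by (intro mult_mat_index_sum) auto
  also have "\<dots> = (\<Sum>y<n. \<Sum>x<n. A $$ (i,x) * B $$ (x,y) * C $$ (y,j))"
    using ij by (intro sum.cong refl) (simp add: mult_mat_index_sum[OF A B] sum_distrib_right del: index_mult_mat)
  finally show ?thesis by (subst sum.swap) simp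
qed

lemma outer_sandwich_index:
  assumes T: "T \<in> carrier_mat n n" and A: "A \<in> carrier_mat n n" and Y: "Y \<in> carrier_mat n n"
    and TY: "\<And>i j. i < n \<Longrightarrow> j < n \<Longrightarrow> T $$ (i,j) = Y $$ (i,k) * cnj (Y $$ (j,k))"
    and ij: "i < n" "j < n" "k < n"
  shows "(T * A * T) $$ (i,j) = Y $$ (i,k) * (adj Y * A * Y) $$ (k,k) * cnj (Y $$ (j,k))"
proof -
  have "(T * A * T) $$ (i,j) = (\<Sum>x<n. \<Sum>y<n. T $$ (i,x) * A $$ (x,y) * T $$ (y,j))"
    by (rule sandwich_index[OF T A T ij(1,2)])
  also have "\<dots> = (\<Sum>x<n. \<Sum>y<n. Y $$ (i,k) * (adj Y $$ (k,x) * A $$ (x,y) * Y $$ (y,k)) * cnj (Y $$ (j,k)))"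
    using ij Y by (intro sum.cong refl) (auto simp: TY)
  also have "\<dots> = Y $$ (i,k) * (adj Y * A * Y) $$ (k,k) * cnj (Y $$ (j,k))"
    unfolding sandwich_index[OF adj_carrier[OF Y] A Y ij(3,3)] sum_distrib_left sum_distrib_right ..
  finally show ?thesis .
qed

lemma hermitian_conj_diag_real:
  assumes A: "A \<in> carrier_mat n n" and herm: "adj A = A" and Y: "Y \<in> carrier_mat n n" and k: "k < n"
  shows "(adj Y * A * Y) $$ (k,k) = complex_of_real (basis_prob Y A k)"
proof -
  have "adj (adj Y * A * Y) = adj Y * A * Y"
    using A Y herm by (simp add: adj_mult[of _ n n _ n] square_mat_simps[where n = n])
  then have "cnj ((adj Y * A * Y) $$ (k,k)) = (adj Y * A * Y) $$ (k,k)"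
    using adj_index[of k "adj Y * A * Y" k] k A Y by (simp del: index_mult_mat(1))
  then show ?thesis by (simp add: basis_prob_def complex_eq_iff)
qed

text \<open>With \<open>T k\<close> the outer product of column \<open>k\<close> of \<open>Y\<close>
  with itself, \<open>T k * A * T k\<close> is \<open>T k\<close> scaled by the diagonal entry of
  \<open>A\<close> at \<open>k\<close> in that basis. For unitary \<open>Y\<close> the sum is
  therefore already a diagonalization.\<close>

lemma pinching_eq_diagonalized:
  assumes A: "A \<in> carrier_mat n n" and herm: "adj A = A" and Y: "Y \<in> carrier_mat n n"
    and T: "\<And>k. k < n \<Longrightarrow> T k \<in> carrier_mat n n"
    and TY: "\<And>k i j. k < n \<Longrightarrow> i < n \<Longrightarrow> j < n \<Longrightarrow> T k $$ (i,j) = Y $$ (i,k) * cnj (Y $$ (j,k))"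
  shows "dephase n n T A = Y * mat_diag n (\<lambda>k. complex_of_real (basis_prob Y A k)) * adj Y" (is "_ = ?R")
proof (rule eq_matI)
  fix i j assume "i < dim_row ?R" "j < dim_col ?R"
  then have ij: "i < n" "j < n" using Y by auto
  have "dephase n n T A $$ (i,j) = (\<Sum>k<n. (T k * A * T k) $$ (i,j))" using ij by (simp add: dephase_def)
  also have "\<dots> = (\<Sum>k<n. Y $$ (i,k) * complex_of_real (basis_prob Y A k) * cnj (Y $$ (j,k)))"
  proof (intro sum.cong refl)
    fix k assume "k \<in> {..<n}"
    then have k: "k < n" by simp
    show "(T k * A * T k) $$ (i,j) = Y $$ (i,k) * complex_of_real (basis_prob Y A k) * cnj (Y $$ (j,k))"
      using outer_sandwich_index[OF T[OF k] A Y TY[OF k] ij k]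
      by (simp only: hermitian_conj_diag_real[OF A herm Y k])
  qed
  also have "\<dots> = (\<Sum>k<n. (Y * mat_diag n (\<lambda>k. complex_of_real (basis_prob Y A k))) $$ (i,k) * adj Y $$ (k,j))"
    using ij Y by (intro sum.cong refl) (simp add: mat_diag_mult_right[OF Y])
  also have "\<dots> = ?R $$ (i,j)"
    by (rule mult_mat_index_sum[symmetric, of _ n n _ n]) (use ij Y in auto)
  finally show "dephase n n T A $$ (i,j) = ?R $$ (i,j)" .
qed (use Y in \<open>auto simp: dephase_def\<close>)

subsection \<open>Bipartitions of the tensor factors\<close>

lemma sdim_insert: "finite S \<Longrightarrow> b \<notin> S \<Longrightarrow> sdim d (insert b S) = d b * sdim d S"
  by (simp add: sdim_def)

lemma place_insert_max: "i \<le> b \<Longrightarrow> place d (insert b S) i = place d S i"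
  unfolding place_def by (rule prod.cong) auto

lemma place_max: "\<forall>j\<in>S. j < b \<Longrightarrow> place d S b = sdim d S"
  unfolding place_def sdim_def by (rule prod.cong) auto

lemma encode_cong: "(\<And>i. i \<in> S \<Longrightarrow> x i = y i) \<Longrightarrow> encode d S x = encode d S y"
  unfolding encode_def by (rule sum.cong) auto

lemma encode_insert_max:
  assumes "finite S" "\<forall>j\<in>S. j < b"
  shows "encode d (insert b S) x = encode d S x + x b * sdim d S"
proof -
  have "b \<notin> S" using assms by auto
  then have "encode d (insert b S) x = x b * place d (insert b S) b + (\<Sum>i\<in>S. x i * place d (insert b S) i)"
    using assms by (simp add: encode_def)
  moreover have "(\<Sum>i\<in>S. x i * place d (insert b S) i) = encode d S x"
    unfolding encode_def using assms by (intro sum.cong refl) (auto simp: place_insert_max)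
  ultimately show ?thesis using assms by (simp add: place_insert_max place_max)
qed

lemma encode_less_sdim:
  assumes "finite S" "\<forall>i\<in>S. x i < d i"
  shows "encode d S x < sdim d S"
  using assms
proof (induction S rule: finite_linorder_max_induct)
  case empty
  then show ?case by (simp add: encode_def sdim_def)
next
  case (insert b S)
  have "encode d (insert b S) x < Suc (x b) * sdim d S"
    using insert by (simp add: encode_insert_max)
  also have "\<dots> \<le> d b * sdim d S" using insert by (intro mult_right_mono) auto
  finally show ?case using insert by (subst sdim_insert) auto
qed

lemma place_dvd_sdim:
  assumes "finite S" "i \<in> S"
  shows "place d S i * d i dvd sdim d S"
proof -
  have "S = {j\<in>S. j < i} \<union> ({i} \<union> {j\<in>S. j > i})" using assms by auto
  then have "sdim d S = prod d ({j\<in>S. j < i} \<union> ({i} \<union> {j\<in>S. j > i}))" by (simp add: sdim_def)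
  also have "\<dots> = place d S i * (d i * prod d {j\<in>S. j > i})"
    using assms by (subst prod.union_disjoint) (auto simp: place_def)
  finally show ?thesis by simp
qed

text \<open>Insert the indices in increasing order. The largest one contributes a multiple of
  \<open>sdim d S\<close>, hence of \<open>place d S i * d i\<close> for smaller \<open>i\<close>,
  which the digit at \<open>i\<close> does not see. The lower part stays below
  \<open>sdim d S\<close>, so the top digit is a plain quotient.\<close>

lemma digit_encode:
  assumes "finite S" "\<forall>i\<in>S. x i < d i" "i \<in> S"
  shows "digit d S (encode d S x) i = x i"
  using assms
proof (induction S arbitrary: i rule: finite_linorder_max_induct)
  case (insert b S)
  have e: "encode d S x < sdim d S" using insert by (intro encode_less_sdim) auto
  show ?case
  proof (cases "i = b")
    case True
    then show ?thesis
      using insert e by (simp add: digit_def place_insert_max place_max encode_insert_max)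
  next
    case False
    then have i: "i \<in> S" "i < b" using insert by auto
    obtain c where c: "sdim d S = place d S i * d i * c" using place_dvd_sdim[OF insert.hyps(1) i(1)] by (auto simp: dvd_def)
    then have pl: "place d S i \<noteq> 0" using e by (cases "place d S i") auto
    have "encode d S x + x b * sdim d S = encode d S x + place d S i * (x b * d i * c)"
      by (simp add: c)
    then have "(encode d S x + x b * sdim d S) div place d S i = encode d S x div place d S i + x b * d i * c"
      by (simp only: div_mult_self2[OF pl] add.commute)
    moreover have "place d (insert b S) i = place d S i" using i(2) by (simp add: place_insert_max)
    ultimately have "digit d (insert b S) (encode d (insert b S) x) i = (encode d S x div place d S i + d i * (x b * c)) mod d i"
      using insert.hyps by (simp add: digit_def encode_insert_max mult_ac)
    also have "\<dots> = digit d S (encode d S x) i" unfolding mod_mult_self2 by (simp add: digit_def)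
    finally show ?thesis using insert i by simp
  qed
qed simp

text \<open>No bound on \<open>m\<close> is assumed, so its digits recover it only modulo the
  dimension; the induction step is the splitting of \<open>mod\<close> by a product.\<close>

lemma encode_digit:
  assumes "finite S"
  shows "encode d S (digit d S m) = m mod sdim d S"
  using assms
proof (induction S rule: finite_linorder_max_induct)
  case empty
  then show ?case by (simp add: encode_def sdim_def)
next
  case (insert b S)
  have "encode d S (digit d (insert b S) m) = encode d S (digit d S m)"
    using insert by (intro encode_cong) (auto simp: digit_def place_insert_max)
  then have "encode d (insert b S) (digit d (insert b S) m) = m mod sdim d S + (m div sdim d S mod d b) * sdim d S"
    using insert by (simp add: encode_insert_max digit_def place_insert_max place_max)
  also have "\<dots> = m mod (sdim d S * d b)" by (simp add: mod_mult2_eq)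
  also have "sdim d S * d b = sdim d (insert b S)" using insert by (subst sdim_insert) auto
  finally show ?case .
qed

lemma sum_swap_innermost:
  "(\<Sum>c\<in>C. \<Sum>x\<in>A. \<Sum>y\<in>B. \<Sum>z\<in>D. \<Sum>w\<in>E. f c x y z w)
    = (\<Sum>x\<in>A. \<Sum>y\<in>B. \<Sum>z\<in>D. \<Sum>w\<in>E. \<Sum>c\<in>C. f c x y z w)"
  by (simp only: sum.swap[where A = C])

locale bipartition =
  fixes d :: "nat \<Rightarrow> nat" and N :: nat and \<gamma> :: "nat set"
  assumes sub: "\<gamma> \<subseteq> {..<N}" and pos: "i < N \<Longrightarrow> d i > 0"
begin

abbreviation "\<gamma>' \<equiv> {..<N} - \<gamma>"
abbreviation "n \<equiv> sdim d {..<N}"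
abbreviation "nA \<equiv> sdim d \<gamma>"
abbreviation "nB \<equiv> sdim d \<gamma>'"
abbreviation "fstI \<equiv> sub_idx d {..<N} \<gamma>"
abbreviation "sndI \<equiv> sub_idx d {..<N} \<gamma>'"
abbreviation "pairI \<equiv> join_idx d N \<gamma>"

lemma fin: "finite \<gamma>" "finite \<gamma>'" using sub finite_subset by auto

lemma digit_less: "i < N \<Longrightarrow> digit d S m i < d i"
  using pos by (simp add: digit_def)

lemma join_less: "pairI a c < n"
  unfolding join_idx_def using digit_less by (intro encode_less_sdim) auto

lemma digit_join:
  "i < N \<Longrightarrow> digit d {..<N} (pairI a c) i = (if i \<in> \<gamma> then digit d \<gamma> a i else digit d \<gamma>' c i)"
  unfolding join_idx_def using digit_less by (subst digit_encode) auto

lemma fstI_less: "fstI m < nA" and sndI_less: "sndI m < nB"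
  unfolding sub_idx_def using digit_less sub fin by (auto intro!: encode_less_sdim)

lemma fstI_join:
  assumes "a < nA"
  shows "fstI (pairI a c) = a"
proof -
  have "fstI (pairI a c) = encode d \<gamma> (digit d \<gamma> a)"
    unfolding sub_idx_def using sub by (intro encode_cong) (auto simp: digit_join)
  then show ?thesis using assms fin by (simp add: encode_digit)
qed

lemma sndI_join:
  assumes "c < nB"
  shows "sndI (pairI a c) = c"
proof -
  have "sndI (pairI a c) = encode d \<gamma>' (digit d \<gamma>' c)"
    unfolding sub_idx_def using sub by (intro encode_cong) (auto simp: digit_join)
  then show ?thesis using assms fin by (simp add: encode_digit)
qed

lemma join_fstI_sndI:
  assumes "m < n"
  shows "pairI (fstI m) (sndI m) = m"
proof -
  have "pairI (fstI m) (sndI m) = encode d {..<N} (digit d {..<N} m)"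
    unfolding join_idx_def
  proof (rule encode_cong)
    fix i assume i: "i \<in> {..<N}"
    show "(if i \<in> \<gamma> then digit d \<gamma> (fstI m) i else digit d \<gamma>' (sndI m) i) = digit d {..<N} m i"
      using i sub fin digit_less by (auto simp: sub_idx_def intro!: digit_encode)
  qed
  then show ?thesis using assms by (simp add: encode_digit)
qed

text \<open>\<open>pairI\<close> is a bijection from pairs of factor indices to product indices,
  with inverse given by \<open>fstI\<close> and \<open>sndI\<close>.\<close>

lemma sum_join: "(\<Sum>m<n. f m) = (\<Sum>a<nA. \<Sum>c<nB. f (pairI a c))"
proof -
  have "(\<Sum>m<n. f m) = (\<Sum>(a,c)\<in>{..<nA} \<times> {..<nB}. f (pairI a c))"
    by (rule sum.reindex_bij_witness[of _ "\<lambda>(a,c). pairI a c" "\<lambda>m. (fstI m, sndI m)"])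
      (auto simp: join_fstI_sndI fstI_join sndI_join fstI_less sndI_less join_less)
  then show ?thesis by (simp add: sum.cartesian_product)
qed

lemma join_eq_iff:
  "a < nA \<Longrightarrow> a' < nA \<Longrightarrow> c < nB \<Longrightarrow> c' < nB \<Longrightarrow> pairI a c = pairI a' c' \<longleftrightarrow> a = a' \<and> c = c'"
  by (metis fstI_join sndI_join)

section \<open>Product operators\<close>

lemma tensor_carrier: "tensor_op d N \<gamma> A B \<in> carrier_mat n n"
  by (simp add: tensor_op_def)

lemma tensor_join:
  assumes "a < nA" "a' < nA" "c < nB" "c' < nB"
  shows "tensor_op d N \<gamma> A B $$ (pairI a c, pairI a' c') = A $$ (a,a') * B $$ (c,c')"
  using assms by (simp add: tensor_op_def join_less fstI_join sndI_join)

text \<open>The sum over product indices factorizes. This serves both the unitarity of a product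
  basis and the overlaps between two product bases.\<close>

lemma adj_tensor_mult_join:
  assumes V: "V \<in> carrier_mat nA nA" "Y \<in> carrier_mat nA nA"
    and W: "W \<in> carrier_mat nB nB" "Z \<in> carrier_mat nB nB"
    and ac: "a < nA" "a' < nA" "c < nB" "c' < nB"
  shows "(adj (tensor_op d N \<gamma> V W) * tensor_op d N \<gamma> Y Z) $$ (pairI a c, pairI a' c')
      = (adj V * Y) $$ (a,a') * (adj W * Z) $$ (c,c')"
proof -
  let ?F = "tensor_op d N \<gamma> V W" and ?G = "tensor_op d N \<gamma> Y Z"
  have "(adj ?F * ?G) $$ (pairI a c, pairI a' c') = (\<Sum>l<n. adj ?F $$ (pairI a c, l) * ?G $$ (l, pairI a' c'))"
    by (rule mult_mat_index_sum[of _ n n _ n]) (simp_all add: tensor_carrier join_less)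
  also have "\<dots> = (\<Sum>l<n. cnj (?F $$ (l, pairI a c)) * ?G $$ (l, pairI a' c'))"
    using carrier_matD[OF tensor_carrier[of V W]] by (intro sum.cong refl) (simp add: join_less)
  also have "\<dots> = (\<Sum>x<nA. \<Sum>y<nB. (adj V $$ (a,x) * Y $$ (x,a')) * (adj W $$ (c,y) * Z $$ (y,c')))"
    unfolding sum_join using ac V W by (intro sum.cong refl) (simp add: tensor_join)
  also have "\<dots> = (\<Sum>x<nA. adj V $$ (a,x) * Y $$ (x,a')) * (\<Sum>y<nB. adj W $$ (c,y) * Z $$ (y,c'))"
    by (simp add: sum_product)
  also have "(\<Sum>x<nA. adj V $$ (a,x) * Y $$ (x,a')) = (adj V * Y) $$ (a,a')"
    by (rule mult_mat_index_sum[symmetric, of _ nA nA _ nA]) (use V ac in auto)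
  also have "(\<Sum>y<nB. adj W $$ (c,y) * Z $$ (y,c')) = (adj W * Z) $$ (c,c')"
    by (rule mult_mat_index_sum[symmetric, of _ nB nB _ nB]) (use W ac in auto)
  finally show ?thesis .
qed

lemma tensor_unitary:
  assumes Y: "unitary_mat nA Y" and Z: "unitary_mat nB Z"
  shows "unitary_mat n (tensor_op d N \<gamma> Y Z)"
proof (rule unitary_matI[OF tensor_carrier], rule eq_matI)
  note Yc = unitary_matD[OF Y] and Zc = unitary_matD[OF Z]
  let ?G = "tensor_op d N \<gamma> Y Z"
  fix i j assume "i < dim_row (1\<^sub>m n)" "j < dim_col (1\<^sub>m n)"
  then have ij: "i < n" "j < n" by auto
  have "(adj ?G * ?G) $$ (pairI (fstI i) (sndI i), pairI (fstI j) (sndI j)) = 1\<^sub>m n $$ (pairI (fstI i) (sndI i), pairI (fstI j) (sndI j))"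
    using Yc Zc by (subst adj_tensor_mult_join)
      (auto simp: fstI_less sndI_less join_less join_eq_iff)
  then show "(adj ?G * ?G) $$ (i,j) = 1\<^sub>m n $$ (i,j)" using ij by (simp only: join_fstI_sndI)
qed (use carrier_matD[OF tensor_carrier] in auto)

section \<open>Partial traces as marginals of joint outcome distributions\<close>

lemma ptrace_carrier: "ptrace d N \<gamma> \<rho> \<in> carrier_mat nA nA"
  by (simp add: ptrace_def)

lemma ptrace_hermitian:
  assumes "\<rho> \<in> carrier_mat n n" "adj \<rho> = \<rho>"
  shows "adj (ptrace d N \<gamma> \<rho>) = ptrace d N \<gamma> \<rho>"
proof -
  have sym: "cnj (\<rho> $$ (j,i)) = \<rho> $$ (i,j)" if "i < n" "j < n" for i j
    using adj_index[of i \<rho> j] assms that by simp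
  show ?thesis by (intro eq_matI) (auto simp: ptrace_def sym join_less)
qed

text \<open>Summing over all outcomes on the second factor inserts the resolution of the identity by
  the columns of \<open>Z\<close>, and what is left of \<rho> is its partial trace.\<close>

lemma basis_prob_ptrace:
  assumes \<rho>: "\<rho> \<in> carrier_mat n n" and Y: "Y \<in> carrier_mat nA nA" and Z: "unitary_mat nB Z"
    and k: "k < nA"
  shows "(\<Sum>c<nB. basis_prob (tensor_op d N \<gamma> Y Z) \<rho> (pairI k c)) = basis_prob Y (ptrace d N \<gamma> \<rho>) k"
proof -
  note Zc = unitary_matD[OF Z]
  let ?G = "tensor_op d N \<gamma> Y Z"
  have expand: "(adj ?G * \<rho> * ?G) $$ (pairI k c, pairI k c)
      = (\<Sum>x<nA. \<Sum>y<nB. \<Sum>x'<nA. \<Sum>y'<nB. (cnj (Y $$ (x,k)) * \<rho> $$ (pairI x y, pairI x' y') * Y $$ (x',k))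
            * (Z $$ (y',c) * cnj (Z $$ (y,c))))"
    if c: "c < nB" for c
  proof -
    have "(adj ?G * \<rho> * ?G) $$ (pairI k c, pairI k c)
        = (\<Sum>p<n. \<Sum>q<n. adj ?G $$ (pairI k c, p) * \<rho> $$ (p,q) * ?G $$ (q, pairI k c))"
      by (rule sandwich_index[OF adj_carrier[OF tensor_carrier] \<rho> tensor_carrier join_less join_less])
    also have "\<dots> = (\<Sum>p<n. \<Sum>q<n. cnj (?G $$ (p, pairI k c)) * \<rho> $$ (p,q) * ?G $$ (q, pairI k c))"
      using carrier_matD[OF tensor_carrier[of Y Z]] by (intro sum.cong refl) (simp add: join_less)
    also have "\<dots> = (\<Sum>x<nA. \<Sum>y<nB. \<Sum>x'<nA. \<Sum>y'<nB. (cnj (Y $$ (x,k)) * \<rho> $$ (pairI x y, pairI x' y') * Y $$ (x',k))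
            * (Z $$ (y',c) * cnj (Z $$ (y,c))))"
      unfolding sum_join using c k by (intro sum.cong refl) (simp add: tensor_join)
    finally show ?thesis .
  qed
  have "(\<Sum>c<nB. (adj ?G * \<rho> * ?G) $$ (pairI k c, pairI k c))
      = (\<Sum>c<nB. \<Sum>x<nA. \<Sum>y<nB. \<Sum>x'<nA. \<Sum>y'<nB. (cnj (Y $$ (x,k)) * \<rho> $$ (pairI x y, pairI x' y') * Y $$ (x',k))
            * (Z $$ (y',c) * cnj (Z $$ (y,c))))"
    using expand by (intro sum.cong refl) simp
  also have "\<dots> = (\<Sum>x<nA. \<Sum>y<nB. \<Sum>x'<nA. \<Sum>y'<nB. (cnj (Y $$ (x,k)) * \<rho> $$ (pairI x y, pairI x' y') * Y $$ (x',k))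
            * (\<Sum>c<nB. Z $$ (y',c) * cnj (Z $$ (y,c))))"
    unfolding sum_distrib_left by (rule sum_swap_innermost)
  \<comment> \<open>Orthonormality of the rows of \<open>Z\<close> forces
    \<open>y' = y\<close>.\<close>
  also have "\<dots> = (\<Sum>x<nA. \<Sum>y<nB. \<Sum>x'<nA. \<Sum>y'<nB. if y' = y then
            cnj (Y $$ (x,k)) * \<rho> $$ (pairI x y, pairI x' y') * Y $$ (x',k) else 0)"
    using unitary_mat_rows[OF Z] by (intro sum.cong refl) simp
  also have "\<dots> = (\<Sum>x<nA. \<Sum>y<nB. \<Sum>x'<nA. cnj (Y $$ (x,k)) * \<rho> $$ (pairI x y, pairI x' y) * Y $$ (x',k))"
    by (intro sum.cong refl) simp
  also have "\<dots> = (\<Sum>x<nA. \<Sum>x'<nA. adj Y $$ (k,x) * ptrace d N \<gamma> \<rho> $$ (x,x') * Y $$ (x',k))"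
    by (rule sum.cong[OF refl], subst sum.swap, rule sum.cong[OF refl])
      (use k Y in \<open>simp add: ptrace_def sum_distrib_left sum_distrib_right\<close>)
  also have "\<dots> = (adj Y * ptrace d N \<gamma> \<rho> * Y) $$ (k,k)"
    by (rule sandwich_index[OF adj_carrier[OF Y] ptrace_carrier Y k k, symmetric])
  finally show ?thesis unfolding basis_prob_def Re_sum[symmetric] by simp
qed

text \<open>The two sides play symmetric roles, so facts about the second factor are instances at
  the complement; the lemmas that follow translate the swapped indices and operators back.\<close>

lemma complement_bipartition: "bipartition d N \<gamma>'"
  using pos by unfold_locales auto

lemma complement_complement: "{..<N} - \<gamma>' = \<gamma>" using sub by auto

lemma join_complement: "join_idx d N \<gamma>' c a = pairI a c"
  unfolding join_idx_def complement_complement by (rule encode_cong) auto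

lemma tensor_complement: "tensor_op d N \<gamma>' B A = tensor_op d N \<gamma> A B"
  unfolding tensor_op_def complement_complement by (simp add: mult.commute)

lemma basis_prob_ptrace_complement:
  assumes \<rho>: "\<rho> \<in> carrier_mat n n" and Y: "unitary_mat nA Y" and Z: "Z \<in> carrier_mat nB nB"
    and k: "k < nB"
  shows "(\<Sum>a<nA. basis_prob (tensor_op d N \<gamma> Y Z) \<rho> (pairI a k)) = basis_prob Z (ptrace d N \<gamma>' \<rho>) k"
  using bipartition.basis_prob_ptrace[OF complement_bipartition \<rho> Z _ k, of Y] Y
  unfolding complement_complement join_complement tensor_complement by simp

text \<open>Numbered by product basis indices, the products of projectors form a single family of
  outer products of the columns of \<open>tensor_op d N \<gamma> Y Z\<close>, so the one-basis
  dephasing result applies.\<close>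

lemma dephase2_eq_diagonalized:
  assumes \<rho>: "\<rho> \<in> carrier_mat n n" "adj \<rho> = \<rho>"
    and P: "\<And>k i j. k < nA \<Longrightarrow> i < nA \<Longrightarrow> j < nA \<Longrightarrow> P k $$ (i,j) = Y $$ (i,k) * cnj (Y $$ (j,k))"
    and Q: "\<And>k i j. k < nB \<Longrightarrow> i < nB \<Longrightarrow> j < nB \<Longrightarrow> Q k $$ (i,j) = Z $$ (i,k) * cnj (Z $$ (j,k))"
  shows "dephase2 d N \<gamma> nA P nB Q \<rho> = tensor_op d N \<gamma> Y Z
     * mat_diag n (\<lambda>m. complex_of_real (basis_prob (tensor_op d N \<gamma> Y Z) \<rho> m)) * adj (tensor_op d N \<gamma> Y Z)"
proof -
  define T where "T m = tensor_op d N \<gamma> (P (fstI m)) (Q (sndI m))" for m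
  have T: "T m \<in> carrier_mat n n" for m by (simp add: T_def tensor_carrier)
  have "dephase2 d N \<gamma> nA P nB Q \<rho> = dephase n n T \<rho>"
    unfolding dephase2_def dephase_def sum_join T_def
    by (intro eq_matI) (auto simp: fstI_join sndI_join simp del: index_mult_mat(1) intro!: sum.cong)
  also have "\<dots> = tensor_op d N \<gamma> Y Z
     * mat_diag n (\<lambda>m. complex_of_real (basis_prob (tensor_op d N \<gamma> Y Z) \<rho> m)) * adj (tensor_op d N \<gamma> Y Z)"
  proof (rule pinching_eq_diagonalized[OF \<rho> tensor_carrier T])
    fix k i j assume "k < n" "i < n" "j < n"
    then show "T k $$ (i,j) = tensor_op d N \<gamma> Y Z $$ (i,k) * cnj (tensor_op d N \<gamma> Y Z $$ (j,k))"
      by (simp add: T_def tensor_op_def P Q fstI_less sndI_less)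
  qed
  finally show ?thesis .
qed

end

subsection \<open>Nonnegativity of the discord\<close>

text \<open>The case \<open>x = 0\<close> agrees because \<open>ln 0 = 0\<close>.\<close>

lemma log2'_nonneg: "x \<ge> 0 \<Longrightarrow> log2' x = ln x / ln 2"
  by (auto simp: log2'_def log_def)

lemma basis_prob_density_nonneg:
  assumes \<rho>: "density_op n \<rho>" and Y: "Y \<in> carrier_mat n n" and k: "k < n"
  shows "basis_prob Y \<rho> k \<ge> 0"
proof -
  have \<rho>c: "\<rho> \<in> carrier_mat n n" using \<rho> by (simp add: density_op_def)
  have v: "col Y k \<in> carrier_vec n" using Y k by auto
  have "(adj Y * \<rho> * Y) $$ (k,k) = (\<Sum>x<n. \<Sum>y<n. adj Y $$ (k,x) * \<rho> $$ (x,y) * Y $$ (y,k))"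
    by (rule sandwich_index[OF adj_carrier[OF Y] \<rho>c Y k k])
  also have "\<dots> = (\<Sum>i<n. cnj (vec_index (col Y k) i) * vec_index (\<rho> *\<^sub>v col Y k) i)"
    using Y k \<rho>c by (intro sum.cong refl) (simp add: scalar_prod_def sum_distrib_left lessThan_atLeast0 mult.assoc)
  finally show ?thesis using \<rho> v unfolding density_op_def basis_prob_def by (auto simp: less_eq_complex_def)
qed

lemma basis_prob_eigen_expansion:
  assumes U: "unitary_mat n U" and A: "A = U * mat_diag n (\<lambda>i. complex_of_real (r i)) * adj U"
    and Y: "Y \<in> carrier_mat n n" and k: "k < n"
  shows "basis_prob Y A k = (\<Sum>i<n. r i * (cmod ((adj U * Y) $$ (i,k)))\<^sup>2)"
proof -
  note Uc = unitary_matD[OF U]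
  note [simp] = square_mat_simps[where n = n] Uc(1,2) Y
  define M where "M = adj U * Y"
  have M: "M \<in> carrier_mat n n" by (simp add: M_def)
  have "adj M = adj Y * U" by (simp add: M_def adj_mult[of _ n n _ n])
  then have "adj Y * A * Y = adj M * mat_diag n (\<lambda>i. complex_of_real (r i)) * M"
    by (simp add: A M_def)
  also have "\<dots> $$ (k,k) = (\<Sum>l<n. (adj M * mat_diag n (\<lambda>i. complex_of_real (r i))) $$ (k,l) * M $$ (l,k))"
    by (rule mult_mat_index_sum[of _ n n _ n]) (use M k in auto)
  also have "\<dots> = (\<Sum>l<n. complex_of_real (r l * (cmod (M $$ (l,k)))\<^sup>2))"
    unfolding of_real_mult complex_norm_square
    using M k by (intro sum.cong refl) (simp add: mat_diag_mult_right[OF adj_carrier[OF M]])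
  finally show ?thesis by (simp add: basis_prob_def M_def)
qed

lemma sum_basis_prob:
  assumes A: "A \<in> carrier_mat n n" and Y: "unitary_mat n Y"
  shows "(\<Sum>k<n. basis_prob Y A k) = Re (tr A)"
  using tr_mult_diagonalized[OF A unitary_matD(1)[OF Y], of "\<lambda>_. 1"] A unitary_matD[OF Y]
  by (simp add: square_mat_simps[where n = n])

text \<open>The operator \<sigma> appears only through its eigenbasis \<open>F\<close>, its
  eigenvalues \<open>s\<close> and its diagonal \<open>q\<close> in the measured basis
  \<open>G\<close>. The support condition is phrased by the diagonal of \<rho> in
  \<open>F\<close>.\<close>

lemma measured_relative_entropy_le_mat:
  assumes \<rho>: "density_op n \<rho>"
    and U: "unitary_mat n U" and \<rho>U: "\<rho> = U * mat_diag n (\<lambda>i. complex_of_real (r i)) * adj U"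
    and F: "unitary_mat n F" and G: "unitary_mat n G"
    and s: "\<And>j. j < n \<Longrightarrow> s j \<ge> 0"
    and supp: "\<And>j. j < n \<Longrightarrow> basis_prob F \<rho> j \<noteq> 0 \<Longrightarrow> s j > 0"
    and q: "\<And>k. k < n \<Longrightarrow> q k = (\<Sum>j<n. s j * (cmod ((adj F * G) $$ (j,k)))\<^sup>2)"
  shows "(\<Sum>k<n. basis_prob G \<rho> k * ln (basis_prob G \<rho> k)) - (\<Sum>k<n. basis_prob G \<rho> k * ln (q k))
     \<le> (\<Sum>i<n. r i * ln (r i)) - (\<Sum>j<n. basis_prob F \<rho> j * ln (s j))"
proof -
  note Uc = unitary_matD[OF U] and Fc = unitary_matD[OF F] and Gc = unitary_matD[OF G]
  have \<rho>c: "\<rho> \<in> carrier_mat n n" "tr \<rho> = 1" using \<rho> by (auto simp: density_op_def)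
  define c where "c = adj U * F"
  define h where "h = adj U * G"
  define m where "m = adj F * G"
  have uc: "unitary_mat n c" and uh: "unitary_mat n h" and um: "unitary_mat n m"
    unfolding c_def h_def m_def by (intro unitary_mat_mult unitary_mat_adj U F G)+
  have r: "r i = basis_prob U \<rho> i" if "i < n" for i
    using basis_prob_eigenbasis[OF U \<rho>U that] by simp
  have r0: "r i \<ge> 0" if "i < n" for i
    using r[OF that] basis_prob_density_nonneg[OF \<rho> Uc(1) that] by simp
  have "sum r {..<n} = 1" using sum_basis_prob[OF \<rho>c(1) U] \<rho>c(2) by (simp add: r)
  moreover have norm_row: "(\<Sum>j<n. (cmod (M $$ (i,j)))\<^sup>2) = 1" if M: "unitary_mat n M" "i < n" for M i
  proof -
    have "complex_of_real (\<Sum>j<n. (cmod (M $$ (i,j)))\<^sup>2) = 1"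
      unfolding of_real_sum complex_norm_square using unitary_mat_rows[OF M(1,2,2)] by simp
    then show ?thesis by (simp only: of_real_eq_1_iff)
  qed
  moreover have "(\<Sum>j<n. c $$ (i,j) * m $$ (j,k)) = h $$ (i,k)" if "i < n" "k < n" for i k
  proof -
    have "c * m = adj U * (F * adj F) * G"
      unfolding c_def m_def using Uc(1,2) Fc(1,2) Gc(1,2) by (simp add: square_mat_simps[where n = n])
    then have "c * m = h" unfolding h_def using Uc(1,2) Fc(4) Gc(1,2) by (simp add: square_mat_simps[where n = n])
    then show ?thesis using mult_mat_index_sum[OF unitary_matD(1)[OF uc] unitary_matD(1)[OF um] that] by simp
  qed
  moreover have "(\<Sum>j<n. m $$ (j,k) * cnj (m $$ (j,k'))) = (if k = k' then 1 else 0)" if "k < n" "k' < n" for k k'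
    using unitary_mat_cols[OF um that(2,1)] by (simp add: mult.commute)
  moreover have p: "basis_prob G \<rho> k = (\<Sum>i<n. r i * (cmod (h $$ (i,k)))\<^sup>2)" if "k < n" for k
    unfolding h_def by (rule basis_prob_eigen_expansion[OF U \<rho>U Gc(1) that])
  moreover have pF: "basis_prob F \<rho> j = (\<Sum>i<n. r i * (cmod (c $$ (i,j)))\<^sup>2)" if "j < n" for j
    unfolding c_def by (rule basis_prob_eigen_expansion[OF U \<rho>U Fc(1) that])
  \<comment> \<open>The diagonal entry of \<rho> at \<open>j\<close> is a sum of nonnegative terms,
    so one nonzero term makes it positive and triggers \<open>supp\<close>.\<close>
  moreover have "s j > 0" if ij: "i < n" "j < n" "r i \<noteq> 0" "c $$ (i,j) \<noteq> 0" for i j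
  proof -
    have "(\<Sum>i<n. r i * (cmod (c $$ (i,j)))\<^sup>2) > 0"
      using ij r0 by (intro sum_pos2[where i = i]) (auto simp: less_le)
    then show ?thesis using supp[OF ij(2)] pF[OF ij(2)] by simp
  qed
  ultimately have "(\<Sum>k<n. basis_prob G \<rho> k * ln (basis_prob G \<rho> k)) - (\<Sum>k<n. basis_prob G \<rho> k * ln (q k))
     \<le> (\<Sum>i<n. r i * ln (r i)) - (\<Sum>i<n. \<Sum>j<n. r i * (cmod (c $$ (i,j)))\<^sup>2 * ln (s j))"
    using r0 s unitary_mat_cols[OF uh] norm_row[OF uc] norm_row[OF uh] q[folded m_def]
    by (intro measured_relative_entropy_le[where m = "\<lambda>j k. m $$ (j,k)" and h = "\<lambda>i k. h $$ (i,k)"]) auto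
  also have "(\<Sum>i<n. \<Sum>j<n. r i * (cmod (c $$ (i,j)))\<^sup>2 * ln (s j)) = (\<Sum>j<n. basis_prob F \<rho> j * ln (s j))"
    by (subst sum.swap) (simp add: pF sum_distrib_right)
  finally show ?thesis .
qed

context bipartition
begin

text \<open>On the support of \<open>p\<close> the logarithm of the product splits; elsewhere the
  weight annihilates both sides. Summing out the other index leaves the marginals.\<close>

lemma product_marginals_ln:
  fixes p :: "nat \<Rightarrow> real"
  assumes A: "\<And>k. k < nA \<Longrightarrow> (\<Sum>c<nB. p (pairI k c)) = pA k"
    and B: "\<And>c. c < nB \<Longrightarrow> (\<Sum>k<nA. p (pairI k c)) = pB c"
    and supp: "\<And>m. m < n \<Longrightarrow> p m \<noteq> 0 \<Longrightarrow> pA (fstI m) > 0 \<and> pB (sndI m) > 0"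
  shows "(\<Sum>m<n. p m * ln (pA (fstI m) * pB (sndI m))) = (\<Sum>k<nA. pA k * ln (pA k)) + (\<Sum>c<nB. pB c * ln (pB c))"
proof -
  have "(\<Sum>m<n. p m * ln (pA (fstI m) * pB (sndI m))) = (\<Sum>m<n. p m * ln (pA (fstI m)) + p m * ln (pB (sndI m)))"
  proof (intro sum.cong refl)
    fix m assume "m \<in> {..<n}"
    then show "p m * ln (pA (fstI m) * pB (sndI m)) = p m * ln (pA (fstI m)) + p m * ln (pB (sndI m))"
      using supp[of m] by (cases "p m = 0") (auto simp: ln_mult distrib_left)
  qed
  also have "\<dots> = (\<Sum>k<nA. \<Sum>c<nB. p (pairI k c) * ln (pA k)) + (\<Sum>k<nA. \<Sum>c<nB. p (pairI k c) * ln (pB c))"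
    unfolding sum.distrib sum_join by (simp add: fstI_join sndI_join)
  also have "(\<Sum>k<nA. \<Sum>c<nB. p (pairI k c) * ln (pA k)) = (\<Sum>k<nA. pA k * ln (pA k))"
    by (intro sum.cong refl) (simp add: A flip: sum_distrib_right)
  also have "(\<Sum>k<nA. \<Sum>c<nB. p (pairI k c) * ln (pB c)) = (\<Sum>c<nB. pB c * ln (pB c))"
    by (subst sum.swap, intro sum.cong refl) (simp add: B flip: sum_distrib_right)
  finally show ?thesis .
qed

text \<open>A marginal dominates each joint entry it collects. This supplies the support condition
  for a state against the product of its reductions.\<close>

lemma marginals_pos:
  fixes p :: "nat \<Rightarrow> real"
  assumes A: "\<And>k. k < nA \<Longrightarrow> (\<Sum>c<nB. p (pairI k c)) = pA k"
    and B: "\<And>c. c < nB \<Longrightarrow> (\<Sum>k<nA. p (pairI k c)) = pB c"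
    and p0: "\<And>m. m < n \<Longrightarrow> p m \<ge> 0" and m: "m < n" "p m \<noteq> 0"
  shows "pA (fstI m) > 0 \<and> pB (sndI m) > 0"
proof -
  have pm: "p (pairI (fstI m) (sndI m)) > 0" using p0[OF m(1)] m by (simp add: join_fstI_sndI)
  have "(\<Sum>c<nB. p (pairI (fstI m) c)) > 0"
    using pm p0 by (intro sum_pos2[where i = "sndI m"]) (auto simp: sndI_less join_less)
  moreover have "(\<Sum>k<nA. p (pairI k (sndI m))) > 0"
    using pm p0 by (intro sum_pos2[where i = "fstI m"]) (auto simp: fstI_less join_less)
  ultimately show ?thesis using A[OF fstI_less, of m] B[OF sndI_less, of m] by simp
qed

text \<open>The main inequality is applied against the product of the reduced states. The logarithms
  of products split into marginal terms, and the result regroups into the three entropy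
  differences.\<close>

lemma discord_integrand_nonneg:
  assumes \<rho>: "density_op n \<rho>" and P: "rank_one_pvm nA mA P" and Q: "rank_one_pvm nB mB Q"
  shows "rel_entropy \<rho> (dephase2 d N \<gamma> mA P mB Q \<rho>)
      - rel_entropy (ptrace d N \<gamma> \<rho>) (dephase nA mA P (ptrace d N \<gamma> \<rho>))
      - rel_entropy (ptrace d N \<gamma>' \<rho>) (dephase nB mB Q (ptrace d N \<gamma>' \<rho>)) \<ge> 0"
proof -
  let ?A = "ptrace d N \<gamma> \<rho>" and ?B = "ptrace d N \<gamma>' \<rho>"
  have \<rho>c: "\<rho> \<in> carrier_mat n n" and \<rho>h: "adj \<rho> = \<rho>" using \<rho> by (auto simp: density_op_def)
  have Ac: "?A \<in> carrier_mat nA nA" "adj ?A = ?A" using ptrace_carrier ptrace_hermitian[OF \<rho>c \<rho>h] by auto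
  have Bc: "?B \<in> carrier_mat nB nB" "adj ?B = ?B"
    using bipartition.ptrace_carrier[OF complement_bipartition]
      bipartition.ptrace_hermitian[OF complement_bipartition \<rho>c \<rho>h] by auto
  obtain U r where U: "unitary_mat n U" and \<rho>U: "\<rho> = U * mat_diag n (\<lambda>i. complex_of_real (r i)) * adj U"
    using hermitian_diagonalization[OF \<rho>c \<rho>h] by blast
  obtain V a where V: "unitary_mat nA V" and AV: "?A = V * mat_diag nA (\<lambda>i. complex_of_real (a i)) * adj V"
    using hermitian_diagonalization[OF Ac] by blast
  obtain W b where W: "unitary_mat nB W" and BW: "?B = W * mat_diag nB (\<lambda>i. complex_of_real (b i)) * adj W"
    using hermitian_diagonalization[OF Bc] by blast
  obtain Y where mA: "mA = nA" and Y: "unitary_mat nA Y"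
    and PY: "\<And>k i j. k < nA \<Longrightarrow> i < nA \<Longrightarrow> j < nA \<Longrightarrow> P k $$ (i,j) = Y $$ (i,k) * cnj (Y $$ (j,k))"
    using rank_one_pvm_unitary[OF P] by metis
  obtain Z where mB: "mB = nB" and Z: "unitary_mat nB Z"
    and QZ: "\<And>k i j. k < nB \<Longrightarrow> i < nB \<Longrightarrow> j < nB \<Longrightarrow> Q k $$ (i,j) = Z $$ (i,k) * cnj (Z $$ (j,k))"
    using rank_one_pvm_unitary[OF Q] by metis
  note Vc = unitary_matD[OF V] and Wc = unitary_matD[OF W] and Yc = unitary_matD[OF Y] and Zc = unitary_matD[OF Z]
  define F where "F = tensor_op d N \<gamma> V W"
  define G where "G = tensor_op d N \<gamma> Y Z"
  have F: "unitary_mat n F" and G: "unitary_mat n G" unfolding F_def G_def by (intro tensor_unitary V W Y Z)+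
  define p where "p = basis_prob G \<rho>"
  define pA where "pA = basis_prob Y ?A"
  define pB where "pB = basis_prob Z ?B"
  have p0: "p m \<ge> 0" if "m < n" for m
    unfolding p_def by (rule basis_prob_density_nonneg[OF \<rho> unitary_matD(1)[OF G] that])
  have f0: "basis_prob F \<rho> m \<ge> 0" if "m < n" for m
    by (rule basis_prob_density_nonneg[OF \<rho> unitary_matD(1)[OF F] that])
  have r0: "r i \<ge> 0" if "i < n" for i
    using basis_prob_eigenbasis[OF U \<rho>U that] basis_prob_density_nonneg[OF \<rho> unitary_matD(1)[OF U] that] by simp
  have margA: "(\<Sum>c<nB. p (pairI k c)) = pA k" if "k < nA" for k
    unfolding p_def pA_def G_def by (rule basis_prob_ptrace[OF \<rho>c Yc(1) Z that])
  have margB: "(\<Sum>k<nA. p (pairI k c)) = pB c" if "c < nB" for c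
    unfolding p_def pB_def G_def by (rule basis_prob_ptrace_complement[OF \<rho>c Y Zc(1) that])
  \<comment> \<open>The diagonal of \<rho> in the product eigenbasis \<open>F\<close> has the
    marginals \<open>a\<close> and \<open>b\<close>, although \<rho> itself need not be diagonal
    there.\<close>
  have marga: "(\<Sum>c<nB. basis_prob F \<rho> (pairI k c)) = a k" if "k < nA" for k
    unfolding F_def basis_prob_ptrace[OF \<rho>c Vc(1) W that] by (rule basis_prob_eigenbasis[OF V AV that])
  have margb: "(\<Sum>k<nA. basis_prob F \<rho> (pairI k c)) = b c" if "c < nB" for c
    unfolding F_def basis_prob_ptrace_complement[OF \<rho>c V Wc(1) that] by (rule basis_prob_eigenbasis[OF W BW that])
  have a0: "a k \<ge> 0" if "k < nA" for k unfolding marga[OF that, symmetric] by (intro sum_nonneg f0 join_less)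
  have b0: "b k \<ge> 0" if "k < nB" for k unfolding margb[OF that, symmetric] by (intro sum_nonneg f0 join_less)
  have pA0: "pA k \<ge> 0" if "k < nA" for k unfolding margA[OF that, symmetric] by (intro sum_nonneg p0 join_less)
  have pB0: "pB k \<ge> 0" if "k < nB" for k unfolding margB[OF that, symmetric] by (intro sum_nonneg p0 join_less)
  have suppF: "a (fstI m) > 0 \<and> b (sndI m) > 0" if "m < n" "basis_prob F \<rho> m \<noteq> 0" for m
    using marginals_pos[OF marga margb f0 that] by simp
  have suppG: "pA (fstI m) > 0 \<and> pB (sndI m) > 0" if "m < n" "p m \<noteq> 0" for m
    using marginals_pos[OF margA margB p0 that] by simp
  \<comment> \<open>The product of the reduced states has eigenbasis \<open>F\<close> and
    eigenvalues \<open>a (fstI j) * b (sndI j)\<close>; its diagonal in the product basis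
    \<open>G\<close> factorizes.\<close>
  have q: "pA (fstI m) * pB (sndI m) = (\<Sum>j<n. a (fstI j) * b (sndI j) * (cmod ((adj F * G) $$ (j,m)))\<^sup>2)"
    if m: "m < n" for m
  proof -
    have "(\<Sum>j<n. a (fstI j) * b (sndI j) * (cmod ((adj F * G) $$ (j,m)))\<^sup>2)
        = (\<Sum>j<nA. \<Sum>l<nB. a j * b l * (cmod ((adj F * G) $$ (pairI j l, pairI (fstI m) (sndI m))))\<^sup>2)"
      unfolding sum_join by (simp add: fstI_join sndI_join join_fstI_sndI[OF m])
    also have "\<dots> = (\<Sum>j<nA. \<Sum>l<nB. (a j * (cmod ((adj V * Y) $$ (j, fstI m)))\<^sup>2) * (b l * (cmod ((adj W * Z) $$ (l, sndI m)))\<^sup>2))"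
      unfolding F_def G_def using Vc(1) Wc(1) Yc(1) Zc(1)
      by (intro sum.cong refl)
        (simp add: adj_tensor_mult_join fstI_less sndI_less norm_mult power_mult_distrib del: index_mult_mat(1))
    also have "\<dots> = pA (fstI m) * pB (sndI m)"
      unfolding pA_def pB_def basis_prob_eigen_expansion[OF V AV Yc(1) fstI_less]
        basis_prob_eigen_expansion[OF W BW Zc(1) sndI_less] sum_product ..
    finally show ?thesis by simp
  qed
  have core: "(\<Sum>k<n. p k * ln (p k)) - (\<Sum>k<n. p k * ln (pA (fstI k) * pB (sndI k)))
     \<le> (\<Sum>i<n. r i * ln (r i)) - (\<Sum>j<n. basis_prob F \<rho> j * ln (a (fstI j) * b (sndI j)))"
    unfolding p_def
    by (rule measured_relative_entropy_le_mat[OF \<rho> U \<rho>U F G])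
      (use suppF q a0 b0 fstI_less sndI_less in auto)
  have "(\<Sum>k<n. p k * ln (pA (fstI k) * pB (sndI k))) = (\<Sum>k<nA. pA k * ln (pA k)) + (\<Sum>c<nB. pB c * ln (pB c))"
    by (rule product_marginals_ln[OF margA margB suppG])
  moreover have "(\<Sum>k<n. basis_prob F \<rho> k * ln (a (fstI k) * b (sndI k))) = (\<Sum>k<nA. a k * ln (a k)) + (\<Sum>c<nB. b c * ln (b c))"
    by (rule product_marginals_ln[OF marga margb suppF])
  ultimately have ineq: "0 \<le> ((\<Sum>i<n. r i * ln (r i)) - (\<Sum>k<n. p k * ln (p k)))
      - ((\<Sum>k<nA. a k * ln (a k)) - (\<Sum>k<nA. pA k * ln (pA k)))
      - ((\<Sum>c<nB. b c * ln (b c)) - (\<Sum>c<nB. pB c * ln (pB c)))"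
    using core by linarith
  \<comment> \<open>All arguments are nonnegative, so passing to base 2 costs only the common
    positive factor \<open>1 / ln 2\<close>.\<close>
  have log2_sum: "(\<Sum>i<k. x i * log2' (x i)) = (\<Sum>i<k. x i * ln (x i)) / ln 2" if "\<And>i. i < k \<Longrightarrow> x i \<ge> 0" for x and k :: nat
    using that by (simp add: log2'_nonneg sum_divide_distrib)
  have PM: "P k \<in> carrier_mat nA nA" if "k < nA" for k using P that mA by (simp add: rank_one_pvm_def)
  have QM: "Q k \<in> carrier_mat nB nB" if "k < nB" for k using Q that mB by (simp add: rank_one_pvm_def)
  have D: "dephase2 d N \<gamma> nA P nB Q \<rho> = G * mat_diag n (\<lambda>m. complex_of_real (p m)) * adj G"
    unfolding G_def p_def by (rule dephase2_eq_diagonalized[OF \<rho>c \<rho>h PY QZ])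
  have DA: "dephase nA nA P ?A = Y * mat_diag nA (\<lambda>k. complex_of_real (pA k)) * adj Y"
    unfolding pA_def by (rule pinching_eq_diagonalized[OF Ac Yc(1) PM PY])
  have DB: "dephase nB nB Q ?B = Z * mat_diag nB (\<lambda>k. complex_of_real (pB k)) * adj Z"
    unfolding pB_def by (rule pinching_eq_diagonalized[OF Bc Zc(1) QM QZ])
  have S: "rel_entropy \<rho> (dephase2 d N \<gamma> mA P mB Q \<rho>) = ((\<Sum>i<n. r i * ln (r i)) - (\<Sum>k<n. p k * ln (p k))) / ln 2"
    using rel_entropy_diagonalized[OF U \<rho>U G D] log2_sum[of n r] log2_sum[of n p] r0 p0
    by (simp add: mA mB diff_divide_distrib flip: p_def)
  have SA: "rel_entropy ?A (dephase nA mA P ?A) = ((\<Sum>k<nA. a k * ln (a k)) - (\<Sum>k<nA. pA k * ln (pA k))) / ln 2"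
    using rel_entropy_diagonalized[OF V AV Y DA] log2_sum[of nA a] log2_sum[of nA pA] a0 pA0
    by (simp add: mA diff_divide_distrib flip: pA_def)
  have SB: "rel_entropy ?B (dephase nB mB Q ?B) = ((\<Sum>c<nB. b c * ln (b c)) - (\<Sum>c<nB. pB c * ln (pB c))) / ln 2"
    using rel_entropy_diagonalized[OF W BW Z DB] log2_sum[of nB b] log2_sum[of nB pB] b0 pB0
    by (simp add: mB diff_divide_distrib flip: pB_def)
  show ?thesis unfolding S SA SB diff_divide_distrib[symmetric] using ineq by simp
qed

text \<open>An infimum inherits a lower bound of a nonempty set; the standard basis measurements
  provide an element.\<close>

lemma gamma_discord_nonneg:
  assumes "density_op n \<rho>"
  shows "gamma_discord d N \<gamma> \<rho> \<ge> 0"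
  unfolding gamma_discord_def
proof (rule cInf_greatest)
  obtain m P m' Q where "rank_one_pvm nA m P" "rank_one_pvm nB m' Q"
    using standard_rank_one_pvm by metis
  then show "{rel_entropy \<rho> (dephase2 d N \<gamma> m P m' Q \<rho>)
      - rel_entropy (ptrace d N \<gamma> \<rho>) (dephase nA m P (ptrace d N \<gamma> \<rho>))
      - rel_entropy (ptrace d N \<gamma>' \<rho>) (dephase nB m' Q (ptrace d N \<gamma>' \<rho>))
      | m P m' Q. rank_one_pvm nA m P \<and> rank_one_pvm nB m' Q} \<noteq> {}" by blast
qed (use discord_integrand_nonneg[OF assms] in auto)

end

theorem theorem1:
  fixes N :: nat and d :: "nat \<Rightarrow> nat" and \<rho> :: "complex mat"
  assumes "N \<ge> 2"
    and "\<forall>i<N. d i > 0"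
    and "density_op (sdim d {..<N}) \<rho>"
  shows "gm_discord d N \<rho> \<ge> 0"
proof -
  define S where "S = {\<gamma>. \<gamma> \<subseteq> {..<N} \<and> \<gamma> \<noteq> {} \<and> \<gamma> \<noteq> {..<N}}"
  have "finite S" unfolding S_def by (rule finite_subset[of _ "Pow {..<N}"]) auto
  \<comment> \<open>For \<open>N \<ge> 2\<close> a single subsystem is a proper part, so the outer
    \<open>Min\<close> ranges over a nonempty set.\<close>
  moreover have "{0} \<in> S"
  proof -
    have "card {..<N} \<noteq> card {0::nat}" using \<open>N \<ge> 2\<close> by simp
    then have "{0} \<noteq> {..<N}" by metis
    then show ?thesis using \<open>N \<ge> 2\<close> by (simp add: S_def)
  qed
  moreover have "gamma_discord d N \<gamma> \<rho> \<ge> 0" if "\<gamma> \<in> S" for \<gamma>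
    using that assms by (intro bipartition.gamma_discord_nonneg) (auto simp: S_def bipartition_def)
  ultimately show ?thesis unfolding gm_discord_def S_def[symmetric] by (intro Min.boundedI) auto
qed

end
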